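(* Let $d\ge3$, $m\in(0,1)$, $m\ne m_*$, and $0<D_1\le D_*\le D_0$. Let $w\in C^1(\mathbb R^d)$ satisfy $V_{D_0}\le wV_{D_*}\le V_{D_1}$, $w-1=f/V_{D_*}$ with $f\in L^1(\mathbb R^d)$ (and, if $m>m_*$, $\int_{\mathbb R^d}f\,dx=0$), and $W_0\le w\le W_1$ for constants $0<W_0\le1\le W_1$ with $$\frac{W_1}{W_0}<\Big(1+\frac{\lambda_{m,d}}{d(1-m)}\Big)^{\frac1{2(2-m)}}.$$ Then $\gamma\,\mathcal F[w]\le\mathcal J[w]$ with $$\gamma=2\,\frac{m-\mathcal C_{m,d}\,d(1-m)\big[(W_1/W_0)^{2(2-m)}-1\big]}{\mathcal C_{m,d}\,W_0^{m-3}W_1^{2(2-m)}}>0,\qquad \mathcal C_{m,d}=m/\lambda_{m,d}.$$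
   Context: $m_*=(d-4)/(d-2)$. $V_D(x)=\big(D+\frac{1-m}{2m}|x|^2\big)^{-1/(1-m)}$. $\mathcal F[w]=\frac1{1-m}\int\big[(w-1)-\frac1m(w^m-1)\big]V_{D_*}^m\,dx$; $\mathcal J[w]=\frac{m}{(m-1)^2}\int\big|\nabla[(w^{m-1}-1)V_{D_*}^{m-1}]\big|^2wV_{D_*}\,dx$. $\lambda_{m,d}:=m\inf_h\frac{\int|\nabla h|^2V_{D_*}dx}{\int|h-\bar h|^2V_{D_*}^{2-m}dx}$ over smooth compactly supported $h$ with support in $\mathbb R^d\setminus\{0\}$, $\bar h=0$ if $m<m_*$ and $\bar h=\int hV_{D_*}^{2-m}/\int V_{D_*}^{2-m}$ if $m>m_*$; it is positive and independent of $D_*$. *)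

theory Defs
  imports "HOL-Analysis.Analysis"
begin

definition m_star :: "nat \<Rightarrow> real" where
  "m_star d = (real d - 4) / (real d - 2)"

definition V :: "real \<Rightarrow> real \<Rightarrow> real^'n \<Rightarrow> real" where
  "V m D x = (D + (1 - m) / (2 * m) * (norm x)\<^sup>2) powr (- 1 / (1 - m))"

definition grad :: "(real^'n \<Rightarrow> real) \<Rightarrow> real^'n \<Rightarrow> real^'n" where
  "grad g x = (THE v. GDERIV g x :> v)"

coinductive smooth_fn :: "(real^'n \<Rightarrow> real) \<Rightarrow> bool" where
  "(\<forall>x. g differentiable (at x)) \<Longrightarrow>
   (\<forall>i. smooth_fn (\<lambda>x. frechet_derivative g (at x) (axis i 1))) \<Longrightarrow> smooth_fn g"

definition test_fn :: "(real^'n \<Rightarrow> real) \<Rightarrow> bool" where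
  "test_fn h \<longleftrightarrow> smooth_fn h \<and> compact (closure {x. h x \<noteq> 0})
                  \<and> 0 \<notin> closure {x. h x \<noteq> 0}"

definition hbar_md :: "real \<Rightarrow> real \<Rightarrow> (real^'n::finite \<Rightarrow> real) \<Rightarrow> real" where
  "hbar_md m Ds (h :: real^'n::finite \<Rightarrow> real) = (if m < m_star CARD('n) then 0
     else (\<integral>x. h x * V m Ds x powr (2 - m) \<partial>lborel) / (\<integral>x. V m Ds (x :: real^'n) powr (2 - m) \<partial>lborel))"

definition lambda_md :: "'n::finite itself \<Rightarrow> real \<Rightarrow> real \<Rightarrow> real" where
  "lambda_md (t :: 'n::finite itself) m Ds = m * Inf {(\<integral>x. (norm (grad h x))\<^sup>2 * V m Ds x \<partial>lborel) /
        (\<integral>x. (h x - hbar_md m Ds h)\<^sup>2 * V m Ds x powr (2 - m) \<partial>lborel) | h :: real^'n \<Rightarrow> real.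
        test_fn h \<and> (\<integral>x. (h x - hbar_md m Ds h)\<^sup>2 * V m Ds x powr (2 - m) \<partial>lborel) \<noteq> 0}"

text \<open>Relative entropy F[w] (integrand nonnegative; nonnegative Lebesgue integral).\<close>
definition F_ent :: "real \<Rightarrow> real \<Rightarrow> (real^'n \<Rightarrow> real) \<Rightarrow> ennreal" where
  "F_ent m Ds w = ennreal (1 / (1 - m)) *
     (\<integral>\<^sup>+ x. ennreal (((w x - 1) - (1 / m) * (w x powr m - 1)) * V m Ds x powr m) \<partial>lborel)"

definition J_fish :: "real \<Rightarrow> real \<Rightarrow> (real^'n \<Rightarrow> real) \<Rightarrow> ennreal" where
  "J_fish m Ds w = ennreal (m / (m - 1)\<^sup>2) *
     (\<integral>\<^sup>+ x. ennreal ((norm (grad (\<lambda>y. (w y powr (m - 1) - 1) * V m Ds y powr (m - 1)) x))\<^sup>2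
                      * w x * V m Ds x) \<partial>lborel)"

end

theory Submission
  imports Defs
begin

text \<open>
  Write \<open>\<rho> = V\<^sup>m\<^sup>-\<^sup>1\<close>, which is a quadratic polynomial, and consider \<open>a \<rho>\<close> for the two functions
  \<open>a = w - 1\<close> and \<open>a = (w\<^sup>m\<^sup>-\<^sup>1 - 1) / (m - 1)\<close>. Integrating the cross term of \<open>|\<nabla>(a \<rho>)|\<^sup>2 V\<close> by parts gives
  \[ \int |\nabla (a \rho)|^2 V = \int |\nabla a|^2 \rho^2 V + \frac{1-m}{m^2} \int a^2 |x|^2 V
     - \frac{d(1-m)}{m} \int a^2 \rho V. \]
  The two choices of \<open>a\<close> and their gradients are pointwise comparable with constants depending on
  \<open>W0\<close> and \<open>W1\<close>. Hence the Dirichlet integral of \<open>g = (w - 1) \<rho>\<close> is bounded by the Fisher information up to a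
  multiple of \<open>\<integral> g\<^sup>2 V\<^sup>2\<^sup>-\<^sup>m\<close>, which the Hardy-Poincare inequality absorbs precisely
  when \<open>W1 / W0\<close> is below the threshold. The entropy is controlled by \<open>\<integral> g\<^sup>2 V\<^sup>2\<^sup>-\<^sup>m\<close> through a
  second-order Taylor bound. The sandwich assumption makes \<open>g\<close> bounded, so that \<open>g\<close> can be reached
  from smooth functions supported away from the origin by cutting off and mollifying.
\<close>

section \<open>Gradients and integrals\<close>

text \<open>Each choice of \<open>a\<close> is dictated by one side of the inequality. For
  \<open>a = w - 1\<close> one has \<open>g V^(2-m) = (w - 1) V = f\<close>, so the mass condition
  says exactly that \<open>g\<close> has weighted mean zero, which is what the spectral gap asks for
  when \<open>m\<close> exceeds \<open>m_star\<close>. For the other choice, \<open>(m - 1)\<close>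
  times the gradient of \<open>a \<rho>\<close> is the field inside \<open>J_fish\<close>. The two
  gradients of \<open>a \<rho>\<close> are not pointwise comparable themselves, since their two
  summands scale by different factors and may cancel. Integration by parts removes the cross term;
  what remains involves only \<open>|\<nabla> a|^2\<close> and \<open>a^2\<close>, and those are
  comparable. The price is the sign of the last term: the positive terms compare with the factor
  \<open>W1^(2(2-m))\<close>, whereas the negative one must be estimated the other way round, with
  \<open>W0^(2(m-2))\<close>. The two factors do not cancel, and the mismatch
  \<open>(W1/W0)^(2(2-m)) - 1\<close> is the quantity in the threshold and in
  \<open>\<gamma>\<close>.\<close>

lemma GDERIV_unique:
  fixes a b :: "'a::euclidean_space"
  assumes "GDERIV f x :> a" "GDERIV f x :> b"
  shows "a = b"
proof -
  have "(\<lambda>h. inner h a) = (\<lambda>h. inner h b)"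
    using assms unfolding gderiv_def by (rule has_derivative_unique)
  then show ?thesis
    by (metis inner_commute vector_eq_rdot)
qed

lemma grad_eq: "GDERIV g x :> v \<Longrightarrow> grad g x = v"
  unfolding grad_def by (rule the_equality) (auto intro: GDERIV_unique)

lemma GDERIV_isCont: "GDERIV g x :> v \<Longrightarrow> isCont g x"
  unfolding gderiv_def by (rule has_derivative_continuous)

lemma GDERIV_imp_continuous_on: "(\<And>x. GDERIV g x :> g' x) \<Longrightarrow> continuous_on UNIV g"
  by (auto intro!: continuous_at_imp_continuous_on GDERIV_isCont)

lemma GDERIV_eq_0:
  fixes g :: "'a::euclidean_space \<Rightarrow> real"
  assumes "GDERIV g x :> v" "open S" "x \<in> S" "\<And>y. y \<in> S \<Longrightarrow> g y = 0"
  shows "v = 0"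
proof -
  have "(g has_derivative (\<lambda>h. inner h 0)) (at x)"
    using assms by (intro has_derivative_transform_within_open[of "\<lambda>_. 0" _ x UNIV S g]) auto
  then show ?thesis
    using assms(1) by (auto intro: GDERIV_unique simp: gderiv_def)
qed

text \<open>Bridge between the Lebesgue integrals of the statement and the Henstock-Kurzweil
  integral over a box, to which the Leibniz rule for differentiation under the integral
  applies.\<close>

lemma integral_cbox_eq_lborel:
  fixes f :: "'a::euclidean_space \<Rightarrow> 'b::euclidean_space"
  assumes "continuous_on UNIV f" "\<And>x. x \<notin> cbox a b \<Longrightarrow> f x = 0"
  shows "integrable lborel f" "integral\<^sup>L lborel f = integral (cbox a b) f"
proof -
  have s: "set_integrable lborel (cbox a b) f"
    unfolding set_integrable_def
    by (rule borel_integrable_compact) (auto intro: continuous_on_subset[OF assms(1)])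
  have e: "(\<lambda>x. indicator (cbox a b) x *\<^sub>R f x) = f"
    using assms(2) by (fastforce simp: indicator_def fun_eq_iff)
  show "integrable lborel f" using s unfolding set_integrable_def e .
  show "integral\<^sup>L lborel f = integral (cbox a b) f"
    using set_borel_integral_eq_integral(2)[OF s] unfolding set_lebesgue_integral_def e .
qed

lemma cball_subset_cbox_one:
  fixes x :: "'a::euclidean_space"
  assumes "norm x \<le> R" shows "x \<in> cbox (- R *\<^sub>R One) (R *\<^sub>R One)"
proof -
  have "\<bar>x \<bullet> i\<bar> \<le> R" if "i \<in> Basis" for i
    using Basis_le_norm[OF that, of x] assms by linarith
  then show ?thesis by (auto simp: mem_box abs_le_iff minus_le_iff)
qed

lemma integrable_bounded_support:
  fixes f :: "'a::euclidean_space \<Rightarrow> 'b::euclidean_space"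
  assumes "continuous_on UNIV f" "\<And>x. norm x > R \<Longrightarrow> f x = 0"
  shows "integrable lborel f"
  using assms cball_subset_cbox_one[of _ R]
  by (intro integral_cbox_eq_lborel(1)[of f "- R *\<^sub>R One" "R *\<^sub>R One"]) force+

text \<open>Serves twice: with \<open>t = 0\<close> as the scaling law behind the radial divergence
  identity, and with \<open>c = -1\<close> as the symmetry of convolution.\<close>

lemma lborel_integral_affine:
  fixes f :: "'a::euclidean_space \<Rightarrow> 'b::euclidean_space"
  assumes [measurable]: "f \<in> borel_measurable borel" and "c \<noteq> 0"
  shows "integral\<^sup>L lborel f = \<bar>c\<bar> ^ DIM('a) *\<^sub>R (\<integral>x. f (t + c *\<^sub>R x) \<partial>lborel)"
proof -
  have "integral\<^sup>L lborel f
      = integral\<^sup>L (density (distr lborel borel (\<lambda>x. t + c *\<^sub>R x)) (\<lambda>_. ennreal (\<bar>c\<bar> ^ DIM('a)))) f"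
    using lborel_affine[OF assms(2), of t] by (simp add: ennreal_power)
  also have "\<dots> = (\<integral>x. \<bar>c\<bar> ^ DIM('a) *\<^sub>R f (t + c *\<^sub>R x) \<partial>lborel)"
    by (subst integral_density) (auto simp: integral_distr)
  finally show ?thesis by simp
qed

lemma GDERIV_integral:
  fixes f :: "'a::euclidean_space \<Rightarrow> 'b::euclidean_space \<Rightarrow> real"
  assumes f: "\<And>x t. GDERIV (\<lambda>x. f x t) x :> f' x t"
    and cont: "\<And>x. continuous_on UNIV (f x)" "continuous_on UNIV (\<lambda>(x, t). f' x t)"
  shows "GDERIV (\<lambda>x. integral (cbox a b) (f x)) x :> integral (cbox a b) (f' x)"
proof -
  have c1: "continuous_on (cbox a b) (f' x)" for x
    by (rule continuous_on_compose2[OF cont(2), where f="\<lambda>t. (x, t)", simplified])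
       (auto intro!: continuous_intros)
  have "((\<lambda>x. integral (cbox a b) (f x)) has_derivative
      blinfun_apply (integral (cbox a b) (\<lambda>t. blinfun_inner_left (f' x t)))) (at x within UNIV)"
  proof (rule leibniz_rule)
    show "continuous_on (UNIV \<times> cbox a b) (\<lambda>(x, t). blinfun_inner_left (f' x t))"
      using bounded_linear.continuous_on[OF bounded_linear_blinfun_inner_left
          continuous_on_subset[OF cont(2), of "UNIV \<times> cbox a b"]]
      by (simp add: case_prod_beta')
    show "f x integrable_on cbox a b" for x
      by (rule integrable_continuous) (auto intro: continuous_on_subset[OF cont(1)])
    show "((\<lambda>x. f x t) has_derivative blinfun_apply (blinfun_inner_left (f' x t))) (at x within UNIV)" for x t
      using f[of t x] unfolding gderiv_def by (simp add: blinfun_inner_left.rep_eq)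
  qed auto
  also have "integral (cbox a b) (\<lambda>t. blinfun_inner_left (f' x t))
      = blinfun_inner_left (integral (cbox a b) (f' x))"
    using integral_linear[OF integrable_continuous[OF c1[of x]] bounded_linear_blinfun_inner_left]
    by (simp add: o_def)
  finally show ?thesis unfolding gderiv_def by (simp add: blinfun_inner_left.rep_eq)
qed

text \<open>Divergence theorem for the field \<open>b(x) x\<close>, obtained by dilation: the
  integral of \<open>b(s x)\<close> is \<open>s^(-d)\<close> times that of \<open>b\<close>, and
  both sides are differentiated at \<open>s = 1\<close>.\<close>

lemma integral_gradient_radial:
  fixes b :: "'a::euclidean_space \<Rightarrow> real"
  assumes b: "\<And>x. GDERIV b x :> b' x" and cont: "continuous_on UNIV b'"
    and supp: "\<And>x. norm x > R \<Longrightarrow> b x = 0"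
  shows "(\<integral>x. b' x \<bullet> x \<partial>lborel) = - real DIM('a) * (\<integral>x. b x \<partial>lborel)"
proof -
  note cb = GDERIV_imp_continuous_on[OF b]
  have [measurable]: "b \<in> borel_measurable borel"
    by (rule borel_measurable_continuous_onI[OF cb])
  \<comment> \<open>The factor 2 leaves room for all dilations with \<open>s > 1/2\<close>:
    \<open>b(s x)\<close> vanishes once \<open>norm x\<close> exceeds \<open>R / s\<close>.\<close>
  define R' where "R' = 2 * max R 0"
  let ?B = "cbox (- R' *\<^sub>R One) (R' *\<^sub>R One) :: 'a set"
  have out: "norm x > R'" if "x \<notin> ?B" for x
    using cball_subset_cbox_one[of x R'] that by force
  have supp': "b' x = 0" if "norm x > R" for x
  proof (rule GDERIV_eq_0[OF b, where S="{x. norm x > R}"])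
    show "open {x::'a. norm x > R}" by (intro open_Collect_less continuous_intros)
  qed (use supp that in auto)
  have sc: "norm (s *\<^sub>R x) > R" if "s > 1/2" "norm x > R'" for s and x::'a
  proof -
    have "R \<le> (1/2) * R'" by (auto simp: R'_def)
    also have "\<dots> \<le> s * R'" using that by (intro mult_right_mono) (auto simp: R'_def)
    also have "\<dots> < s * norm x" using that by (intro mult_strict_left_mono) auto
    finally show ?thesis using that by simp
  qed
  have D1: "((\<lambda>s. integral ?B (\<lambda>x. b (s *\<^sub>R x))) has_real_derivative integral ?B (\<lambda>x. b' (1 *\<^sub>R x) \<bullet> x)) (at 1 within {1/2<..})"
  proof (rule leibniz_rule_field_derivative)
    show "((\<lambda>x. b (x *\<^sub>R t)) has_real_derivative b' (x *\<^sub>R t) \<bullet> t) (at x within {1/2<..})"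
      if "x \<in> {1/2<..}" for x and t :: 'a
    proof -
      have "((\<lambda>x. b (x *\<^sub>R t)) has_derivative (\<lambda>h. (h *\<^sub>R t) \<bullet> b' (x *\<^sub>R t))) (at x within {1/2<..})"
        by (rule has_derivative_in_compose2[where t=UNIV and g=b and g'="\<lambda>y h. h \<bullet> b' y"])
           (use b that in \<open>auto simp: gderiv_def intro!: derivative_eq_intros\<close>)
      then show ?thesis
        by (simp add: has_field_derivative_def inner_commute mult_commute_abs)
    qed
    show "(\<lambda>y. b (x *\<^sub>R y)) integrable_on ?B" for x
      by (rule integrable_continuous) (auto intro!: continuous_intros continuous_on_compose2[OF cb])
    show "continuous_on ({1/2<..} \<times> ?B) (\<lambda>(x, t). b' (x *\<^sub>R t) \<bullet> t)"
      unfolding case_prod_beta'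
      by (auto intro!: continuous_intros continuous_on_compose2[OF cont])
  qed auto
  have e: "integral ?B (\<lambda>x. b (s *\<^sub>R x)) = inverse (s ^ DIM('a)) * integral\<^sup>L lborel b" if "s > 1/2" for s
  proof -
    have "integral ?B (\<lambda>x. b (s *\<^sub>R x)) = (\<integral>x. b (s *\<^sub>R x) \<partial>lborel)"
      by (rule integral_cbox_eq_lborel(2)[symmetric])
         (use that in \<open>auto intro!: continuous_intros continuous_on_compose2[OF cb] supp sc out\<close>)
    then show ?thesis
      using lborel_integral_affine[of b s 0] that by (simp add: field_simps)
  qed
  have D2: "((\<lambda>s. inverse (s ^ DIM('a)) * integral\<^sup>L lborel b) has_real_derivative
     (- real DIM('a) * integral\<^sup>L lborel b)) (at 1 within {1/2<..})"
    by (auto intro!: derivative_eq_intros)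
  have "((\<lambda>s. integral ?B (\<lambda>x. b (s *\<^sub>R x))) has_real_derivative (- real DIM('a) * integral\<^sup>L lborel b))
     (at 1 within {1/2<..})"
    by (rule has_field_derivative_transform_within[OF D2 zero_less_one]) (auto simp del: scaleR_minus_left simp: e)
  with D1 have eq: "integral ?B (\<lambda>x. b' (1 *\<^sub>R x) \<bullet> x) = - real DIM('a) * integral\<^sup>L lborel b"
    by (simp add: has_field_derivative_unique at_within_open[of _ "{1/2<..}"] DERIV_unique)
  have "(\<integral>x. b' x \<bullet> x \<partial>lborel) = integral ?B (\<lambda>x. b' x \<bullet> x)"
  proof (rule integral_cbox_eq_lborel(2))
    show "continuous_on UNIV (\<lambda>x. b' x \<bullet> x)" by (intro continuous_intros cont)
    show "b' x \<bullet> x = 0" if "x \<notin> ?B" for x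
      using out[OF that] supp'[of x] by (simp add: R'_def max_def split: if_splits)
  qed
  with eq show ?thesis by simp
qed

section \<open>Smooth functions and convolutions\<close>

text \<open>The classical flat function \<open>exp (-1/t)\<close>, with the denominators
  \<open>t^k\<close> included so that every derivative is again a linear combination of members of
  the family.\<close>

definition flat :: "nat \<Rightarrow> real \<Rightarrow> real" where
  "flat k t = (if t > 0 then exp (- 1 / t) / t ^ k else 0)"

lemma flat_nonneg: "flat k t \<ge> 0"
  by (simp add: flat_def)

lemma flat_tendsto_0: "(flat k \<longlongrightarrow> 0) (at 0)"
proof (rule filterlim_split_at)
  show "(flat k \<longlongrightarrow> 0) (at_left 0)"
    by (rule tendsto_eventually) (auto simp: flat_def eventually_at_filter)
  have "((\<lambda>t. inverse t ^ k / exp (inverse t)) \<longlongrightarrow> (0::real)) (at_right 0)"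
    by (rule filterlim_compose[OF tendsto_power_div_exp_0 filterlim_inverse_at_top_right])
  then show "(flat k \<longlongrightarrow> 0) (at_right 0)"
    by (rule Lim_transform_eventually)
       (auto simp: flat_def eventually_at_filter exp_minus field_simps)
qed

lemma flat_has_derivative:
  "(flat k has_real_derivative (flat (k + 2) t - real k * flat (k + 1) t)) (at t)"
proof -
  consider "t > 0" | "t < 0" | "t = 0" by linarith
  then show ?thesis
  proof cases
    case 1
    have inv: "((\<lambda>t. inverse (t ^ k)) has_real_derivative - (real k * inverse (t ^ (k + 1)))) (at t)"
      using 1 by (cases k) (force intro!: derivative_eq_intros simp del: power_Suc simp: field_simps simp flip: power_Suc power_add power_Suc2)+
    have ex: "((\<lambda>t. exp (- 1 / t)) has_real_derivative exp (- 1 / t) / t\<^sup>2) (at t)"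
      using 1 by (auto intro!: derivative_eq_intros simp: power2_eq_square)
    have "((\<lambda>t. exp (- 1 / t) * inverse (t ^ k)) has_real_derivative (flat (k + 2) t - real k * flat (k + 1) t)) (at t)"
      using 1 by (intro DERIV_cong[OF DERIV_mult[OF ex inv]]) (simp add: flat_def field_simps power2_eq_square)
    then show ?thesis
      by (rule has_field_derivative_transform_within_open[where S="{0<..}"])
         (use 1 in \<open>auto simp: flat_def field_simps\<close>)
  next
    case 2
    have "((\<lambda>_. 0) has_real_derivative (flat (k + 2) t - real k * flat (k + 1) t)) (at t)"
      using 2 by (auto simp: flat_def)
    then show ?thesis
      by (rule has_field_derivative_transform_within_open[where S="{..<0}"])
         (use 2 in \<open>auto simp: flat_def\<close>)
  next
    case 3
    \<comment> \<open>At 0 the difference quotient of \<open>flat k\<close> is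
      \<open>flat (k + 1)\<close> itself, because \<open>flat k 0 = 0\<close>.\<close>
    have "((\<lambda>h. (flat k (0 + h) - flat k 0) / h) \<longlongrightarrow> 0) (at 0)"
      by (rule Lim_transform_eventually[OF flat_tendsto_0[of "Suc k"]])
         (auto simp: flat_def eventually_at_filter)
    then show ?thesis
      by (simp add: 3 DERIV_def flat_def)
  qed
qed

text \<open>A syntactic class that contains compactly supported bumps and is stable under partial
  derivatives. Coordinates and products are there because the chain rule for
  \<open>r - |x - c|^2\<close> produces the factors \<open>x $ i - c $ i\<close>.\<close>

inductive bump_algebra :: "(real^'n \<Rightarrow> real) \<Rightarrow> bool" where
  const: "bump_algebra (\<lambda>_. a)"
| coord: "bump_algebra (\<lambda>x. x $ i)"
| flat: "bump_algebra (\<lambda>x. flat k (r - (x - c) \<bullet> (x - c)))"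
| add: "bump_algebra f \<Longrightarrow> bump_algebra g \<Longrightarrow> bump_algebra (\<lambda>x. f x + g x)"
| mult: "bump_algebra f \<Longrightarrow> bump_algebra g \<Longrightarrow> bump_algebra (\<lambda>x. f x * g x)"

lemma bump_algebra_gradient:
  fixes g :: "real^'n \<Rightarrow> real"
  assumes "bump_algebra g"
  shows "\<exists>g'. (\<forall>i. bump_algebra (\<lambda>x. g' x $ i)) \<and> (\<forall>x. GDERIV g x :> g' x)"
  using assms
proof induction
  case (const a)
  show ?case
    by (intro exI[of _ "\<lambda>_. 0"]) (auto intro: bump_algebra.const GDERIV_const)
next
  case (coord i)
  have "GDERIV (\<lambda>x. x $ i) x :> axis i 1" for x :: "real^'n"
    unfolding gderiv_def by (simp add: inner_axis bounded_linear_imp_has_derivative bounded_linear_vec_nth)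
  then show ?case
    by (intro exI[of _ "\<lambda>_. axis i 1"]) (auto intro: bump_algebra.const)
next
  case (flat k r c)
  let ?g = "\<lambda>x. (flat (k + 2) (r - (x - c) \<bullet> (x - c)) + (- real k) * flat (k + 1) (r - (x - c) \<bullet> (x - c))) *\<^sub>R ((-2) *\<^sub>R (x - c))"
  have "bump_algebra (\<lambda>x. ?g x $ i)" for i
  proof -
    have "(\<lambda>x. ?g x $ i) = (\<lambda>x. (flat (k + 2) (r - (x - c) \<bullet> (x - c)) + (- real k) * flat (k + 1) (r - (x - c) \<bullet> (x - c))) * ((-2) * (x $ i + (- (c $ i)))))"
      by (simp add: algebra_simps)
    show ?thesis
      unfolding \<open>(\<lambda>x. ?g x $ i) = _\<close> by (intro bump_algebra.intros)
  qed
  moreover have "GDERIV (\<lambda>x. flat k (r - (x - c) \<bullet> (x - c))) x :> ?g x" for x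
  proof -
    have "GDERIV (\<lambda>x. r - (x - c) \<bullet> (x - c)) x :> (-2) *\<^sub>R (x - c)"
      unfolding gderiv_def
      by (auto intro!: derivative_eq_intros simp: inner_commute algebra_simps)
    from GDERIV_DERIV_compose[OF this flat_has_derivative] show ?thesis
      by simp
  qed
  ultimately show ?case by (intro exI[of _ ?g]) auto
next
  case (add f g)
  then obtain f' g' where
    "\<forall>i. bump_algebra (\<lambda>x. f' x $ i)" "\<forall>x. GDERIV f x :> f' x"
    "\<forall>i. bump_algebra (\<lambda>x. g' x $ i)" "\<forall>x. GDERIV g x :> g' x" by blast
  then show ?case
    by (intro exI[of _ "\<lambda>x. f' x + g' x"]) (auto intro!: bump_algebra.add GDERIV_add)
next
  case (mult f g)
  then obtain f' g' where
    "\<forall>i. bump_algebra (\<lambda>x. f' x $ i)" "\<forall>x. GDERIV f x :> f' x"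
    "\<forall>i. bump_algebra (\<lambda>x. g' x $ i)" "\<forall>x. GDERIV g x :> g' x" by blast
  with mult.hyps show ?case
    by (intro exI[of _ "\<lambda>x. f x *\<^sub>R g' x + g x *\<^sub>R f' x"])
       (auto intro!: bump_algebra.add bump_algebra.mult GDERIV_mult)
qed

lemma bump_algebra_continuous: "bump_algebra g \<Longrightarrow> continuous_on UNIV g"
  using bump_algebra_gradient[of g] GDERIV_imp_continuous_on by blast

lemma continuous_on_vec_components:
  fixes f :: "'a::topological_space \<Rightarrow> real^'n"
  assumes "\<And>i. continuous_on S (\<lambda>x. f x $ i)"
  shows "continuous_on S f"
  using continuous_on_vec_lambda[of S "\<lambda>i x. f x $ i"] assms by simp

text \<open>Coinduction for \<open>smooth_fn\<close> in usable form: a family stable under partial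
  derivatives is its own invariant.\<close>

lemma smooth_fn_closed_family:
  assumes "X g"
    and X: "\<And>g. X g \<Longrightarrow> \<exists>g'. (\<forall>i. X (\<lambda>x. g' x $ i)) \<and> (\<forall>x. GDERIV g x :> g' x)"
  shows "smooth_fn g"
  using assms(1)
proof (coinduction arbitrary: g)
  case smooth_fn
  obtain g' where g': "\<And>i. X (\<lambda>x. g' x $ i)" "\<And>x. GDERIV g x :> g' x"
    using X[OF smooth_fn] by blast
  have "frechet_derivative g (at x) (axis i 1) = g' x $ i" for x i
  proof -
    have "frechet_derivative g (at x) = (\<lambda>h. h \<bullet> g' x)"
      using g'(2)[of x] unfolding gderiv_def by (rule frechet_derivative_at[symmetric])
    then show ?thesis by (simp add: inner_axis')
  qed
  moreover have "g differentiable (at x)" for x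
    using g'(2)[of x] unfolding gderiv_def differentiable_def by blast
  ultimately show ?case using g' by auto
qed

lemma bump_algebra_smooth: "bump_algebra g \<Longrightarrow> smooth_fn g"
  by (erule smooth_fn_closed_family[where X=bump_algebra]) (rule bump_algebra_gradient)

text \<open>Moving the derivatives of a convolution onto the kernel shows that it is as smooth as the kernel.\<close>

lemma smooth_fn_convolution:
  fixes f :: "real^'n \<Rightarrow> real"
  assumes "bump_algebra \<phi>" and f: "continuous_on UNIV f"
  shows "smooth_fn (\<lambda>x. integral (cbox a b) (\<lambda>y. f y * \<phi> (x - y)))"
proof -
  define X where "X g \<longleftrightarrow> (\<exists>\<phi>. bump_algebra \<phi> \<and> g = (\<lambda>x. integral (cbox a b) (\<lambda>y. f y * \<phi> (x - y))))" for g
  have "\<exists>g'. (\<forall>i. X (\<lambda>x. g' x $ i)) \<and> (\<forall>x. GDERIV g x :> g' x)" if g: "X g" for g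
  proof -
    obtain \<phi> where \<phi>: "bump_algebra \<phi>" "g = (\<lambda>x. integral (cbox a b) (\<lambda>y. f y * \<phi> (x - y)))"
      using g unfolding X_def by blast
    obtain \<phi>' where \<phi>': "\<And>i. bump_algebra (\<lambda>x. \<phi>' x $ i)" "\<And>x. GDERIV \<phi> x :> \<phi>' x"
      using bump_algebra_gradient[OF \<phi>(1)] by blast
    have c: "continuous_on UNIV \<phi>" "continuous_on UNIV \<phi>'"
      using \<phi> \<phi>' by (auto intro!: bump_algebra_continuous continuous_on_vec_components)
    let ?g = "\<lambda>x. integral (cbox a b) (\<lambda>y. f y *\<^sub>R \<phi>' (x - y))"
    have int: "(\<lambda>y. f y *\<^sub>R \<phi>' (x - y)) integrable_on cbox a b" for x
      by (intro integrable_continuous continuous_intros continuous_on_subset[OF f]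
          continuous_on_compose2[OF c(2)]) auto
    have "GDERIV g x :> ?g x" for x
      unfolding \<phi>(2)
    proof (rule GDERIV_integral)
      fix x t
      have "((\<lambda>x. \<phi> (x - t)) has_derivative (\<lambda>h. h \<bullet> \<phi>' (x - t))) (at x)"
        using \<phi>'(2) unfolding gderiv_def
        by (auto intro!: derivative_eq_intros has_derivative_compose[of "\<lambda>x. x - t" _ x UNIV \<phi>])
      then have "GDERIV (\<lambda>x. \<phi> (x - t)) x :> \<phi>' (x - t)" by (simp add: gderiv_def)
      from GDERIV_mult[OF GDERIV_const[of "f t" x] this]
      show "GDERIV (\<lambda>x. f t * \<phi> (x - t)) x :> f t *\<^sub>R \<phi>' (x - t)" by simp
    next
      show "continuous_on UNIV (\<lambda>y. f y * \<phi> (x - y))" for x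
        by (intro continuous_intros f continuous_on_compose2[OF c(1)]) auto
      show "continuous_on UNIV (\<lambda>(x, y). f y *\<^sub>R \<phi>' (x - y))"
        unfolding case_prod_beta'
        by (intro continuous_intros continuous_on_compose2[OF f] continuous_on_compose2[OF c(2)]) auto
    qed
    moreover have "X (\<lambda>x. ?g x $ i)" for i
    proof -
      have "?g x $ i = integral (cbox a b) (\<lambda>y. f y * \<phi>' (x - y) $ i)" for x
        using integral_linear[OF int[of x] bounded_linear_vec_nth[of i]] by (simp add: o_def)
      then show ?thesis
        unfolding X_def using \<phi>'(1)[of i] by auto
    qed
    ultimately show ?thesis by (intro exI[of _ ?g]) auto
  qed
  moreover have "X (\<lambda>x. integral (cbox a b) (\<lambda>y. f y * \<phi> (x - y)))"
    using assms(1) unfolding X_def by blast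
  ultimately show ?thesis by (rule smooth_fn_closed_family[where X=X, rotated])
qed

section \<open>Mollification and cutoff functions\<close>

text \<open>A nonnegative function with zero integral vanishes almost everywhere, but the positivity
  set of a continuous function is open, and a nonempty open set is not negligible.\<close>

lemma integral_pos_continuous:
  fixes f :: "'a::euclidean_space \<Rightarrow> real"
  assumes "continuous_on UNIV f" "integrable lborel f" "\<And>x. f x \<ge> 0" "f x0 > 0"
  shows "(\<integral>x. f x \<partial>lborel) > 0"
proof (rule ccontr)
  assume "\<not> ?thesis"
  moreover have "(\<integral>x. f x \<partial>lborel) \<ge> 0"
    using assms(3) by (intro Bochner_Integration.integral_nonneg)
  ultimately have "(\<integral>x. f x \<partial>lborel) = 0" by simp
  then have "AE x in lborel. f x = 0"
    using integral_nonneg_eq_0_iff_AE[OF assms(2)] assms(3) by auto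
  moreover have o: "open {x. f x > 0}"
    using assms(1) by (intro open_Collect_less) auto
  ultimately have "{x. f x > 0} \<in> null_sets lborel"
    by (subst AE_iff_null_sets) (auto intro: borel_open elim!: eventually_mono)
  then have "negligible {x. f x > 0}"
    by (simp add: negligible_iff_null_sets null_sets_completionI)
  then show False
    using open_not_negligible[OF o] assms(4) by auto
qed

lemma uniformly_continuous_bounded_support:
  fixes F :: "'a::euclidean_space \<Rightarrow> 'b::euclidean_space"
  assumes "continuous_on UNIV F" "\<And>x. norm x > R \<Longrightarrow> F x = 0" "e > 0"
  shows "\<exists>d>0. \<forall>x z. norm z < d \<longrightarrow> norm (F (x - z) - F x) \<le> e"
proof -
  \<comment> \<open>Enlarging the ball by 1 and capping the shift at 1 leaves two cases: both points
    lie in the compact ball, or both lie outside the support.\<close>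
  have "uniformly_continuous_on (cball 0 (R + 1)) F"
    by (intro compact_uniformly_continuous continuous_on_subset[OF assms(1)]) auto
  then obtain d where d: "d > 0"
    "\<And>x y. x \<in> cball 0 (R + 1) \<Longrightarrow> y \<in> cball 0 (R + 1) \<Longrightarrow> dist y x < d \<Longrightarrow> dist (F y) (F x) < e"
    using assms(3) unfolding uniformly_continuous_on_def by metis
  show ?thesis
  proof (intro exI[of _ "min d 1"] conjI allI impI)
    fix x z :: 'a assume z: "norm z < min d 1"
    have t: "norm x \<le> norm (x - z) + norm z" "norm (x - z) \<le> norm x + norm z"
      using norm_triangle_ineq[of "x - z" z] norm_triangle_ineq4[of x z] by auto
    show "norm (F (x - z) - F x) \<le> e"
    proof (cases "norm x \<le> R + 1 \<and> norm (x - z) \<le> R + 1")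
      case True
      with d(2)[of x "x - z"] z show ?thesis by (simp add: dist_norm norm_minus_commute less_imp_le)
    next
      case False
      then have "norm x > R" "norm (x - z) > R" using t z by auto
      then show ?thesis using assms by auto
    qed
  qed (use d in auto)
qed

lemma mollifier_exists:
  assumes "\<delta> > 0"
  obtains \<phi> :: "real^'n \<Rightarrow> real" where "bump_algebra \<phi>" "\<And>x. \<phi> x \<ge> 0" "\<And>x. norm x \<ge> \<delta> \<Longrightarrow> \<phi> x = 0"
    "(\<integral>x. \<phi> x \<partial>lborel) = 1"
proof -
  define \<phi>0 where "\<phi>0 x = flat 0 (\<delta>\<^sup>2 - (x - 0) \<bullet> (x - 0))" for x :: "real^'n"
  have b: "bump_algebra \<phi>0" unfolding \<phi>0_def by (rule bump_algebra.flat)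
  have z: "\<phi>0 x = 0" if "norm x \<ge> \<delta>" for x
  proof -
    have "\<delta>\<^sup>2 \<le> x \<bullet> x" using power_mono[OF that, of 2] assms by (simp add: power2_norm_eq_inner)
    then show ?thesis by (simp add: \<phi>0_def flat_def)
  qed
  have nn: "\<phi>0 x \<ge> 0" for x by (simp add: \<phi>0_def flat_nonneg)
  have i: "integrable lborel \<phi>0"
    by (rule integrable_bounded_support[OF bump_algebra_continuous[OF b], of \<delta>]) (auto intro: z)
  have pos: "(\<integral>x. \<phi>0 x \<partial>lborel) > 0"
    by (rule integral_pos_continuous[OF bump_algebra_continuous[OF b] i nn, of 0])
       (use assms in \<open>auto simp: \<phi>0_def flat_def\<close>)
  show thesis
    by (rule that[of "\<lambda>x. inverse (\<integral>x. \<phi>0 x \<partial>lborel) * \<phi>0 x"])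
       (use pos z nn bump_algebra.mult[OF bump_algebra.const b] in auto)
qed

text \<open>The convolution averages \<open>F (x - z)\<close> over \<open>norm z < \<delta>\<close>
  with total weight 1, so it inherits the oscillation bound. The vector-valued form covers a
  function and its gradient alike.\<close>

lemma mollification_close:
  fixes F :: "'a::euclidean_space \<Rightarrow> 'b::euclidean_space"
  assumes \<phi>: "continuous_on UNIV \<phi>" "\<And>x. \<phi> x \<ge> 0" "\<And>x. norm x \<ge> \<delta> \<Longrightarrow> \<phi> x = 0"
    "(\<integral>x. \<phi> x \<partial>lborel) = 1"
    and F: "continuous_on UNIV F" "\<And>z. norm z < \<delta> \<Longrightarrow> norm (F (x - z) - F x) \<le> e"
  shows "norm ((\<integral>z. \<phi> z *\<^sub>R F (x - z) \<partial>lborel) - F x) \<le> e"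
proof -
  have i1: "integrable lborel \<phi>"
    by (rule integrable_bounded_support[OF \<phi>(1), of \<delta>]) (auto intro: \<phi>)
  have i2: "integrable lborel (\<lambda>z. \<phi> z *\<^sub>R F (x - z))"
    by (rule integrable_bounded_support[of _ \<delta>])
       (auto intro!: continuous_intros \<phi>(1) continuous_on_compose2[OF F(1)] simp: \<phi>(3))
  have "(\<integral>z. \<phi> z *\<^sub>R F (x - z) \<partial>lborel) - F x = (\<integral>z. \<phi> z *\<^sub>R (F (x - z) - F x) \<partial>lborel)"
    using i1 i2 \<phi>(4) by (simp add: scaleR_diff_right)
  also have "norm \<dots> \<le> (\<integral>z. e * \<phi> z \<partial>lborel)"
  proof (rule Bochner_Integration.integral_norm_bound_integral)
    show "integrable lborel (\<lambda>z. \<phi> z *\<^sub>R (F (x - z) - F x))"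
      using i1 i2 by (simp add: scaleR_diff_right)
    show "norm (\<phi> z *\<^sub>R (F (x - z) - F x)) \<le> e * \<phi> z" for z
      using F(2)[of z] \<phi>(2)[of z] \<phi>(3)[of z] mult_left_mono[of "norm (F (x - z) - F x)" e "\<phi> z"]
      by (cases "norm z < \<delta>") (auto simp: mult.commute)
  qed (use i1 in auto)
  also have "\<dots> = e" using \<phi>(4) by simp
  finally show ?thesis .
qed

text \<open>Convolution with a mollifier is read in two ways. With the shift on \<open>G\<close> the
  derivative falls on \<open>G\<close>, which gives uniform closeness of the gradients; with the
  shift on the kernel it falls on the kernel, which gives smoothness.\<close>

lemma test_fn_approximation:
  fixes G :: "real^'n \<Rightarrow> real"
  assumes G: "\<And>x. GDERIV G x :> G' x" "continuous_on UNIV G'"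
    and supp: "\<And>x. norm x < r \<or> norm x > R \<Longrightarrow> G x = 0" and "r > 0" "e > 0"
  shows "\<exists>h h'. test_fn h \<and> (\<forall>x. GDERIV h x :> h' x) \<and> continuous_on UNIV h'
    \<and> (\<forall>x. \<bar>h x - G x\<bar> \<le> e) \<and> (\<forall>x. norm (h' x - G' x) \<le> e) \<and> (\<forall>x. norm x > R + 1 \<longrightarrow> h x = 0)"
proof -
  note cG = GDERIV_imp_continuous_on[OF G(1)]
  have supp': "G' x = 0" if "norm x > R" for x
  proof (rule GDERIV_eq_0[OF G(1), where S="{x. norm x > R}"])
    show "open {x::real^'n. norm x > R}" by (intro open_Collect_less continuous_intros)
  qed (use supp that in auto)
  obtain d1 where d1: "d1 > 0" "\<And>x z. norm z < d1 \<Longrightarrow> norm (G (x - z) - G x) \<le> e"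
    using uniformly_continuous_bounded_support[OF cG _ \<open>e > 0\<close>, of R] supp by blast
  obtain d2 where d2: "d2 > 0" "\<And>x z. norm z < d2 \<Longrightarrow> norm (G' (x - z) - G' x) \<le> e"
    using uniformly_continuous_bounded_support[OF G(2) supp' \<open>e > 0\<close>] by blast
  \<comment> \<open>\<open>d1\<close> and \<open>d2\<close> control the two errors,
    \<open>r / 2\<close> keeps the support away from the origin, and 1 keeps it within radius
    \<open>R + 1\<close>.\<close>
  define \<delta> where "\<delta> = min (min d1 d2) (min (r / 2) 1)"
  have \<delta>: "\<delta> > 0" "\<delta> \<le> d1" "\<delta> \<le> d2" "\<delta> \<le> r / 2" "\<delta> \<le> 1"
    using d1 d2 \<open>r > 0\<close> by (auto simp: \<delta>_def)
  obtain \<phi> :: "real^'n \<Rightarrow> real" where \<phi>: "bump_algebra \<phi>" "\<And>x. \<phi> x \<ge> 0"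
    "\<And>x. norm x \<ge> \<delta> \<Longrightarrow> \<phi> x = 0" "(\<integral>x. \<phi> x \<partial>lborel) = 1"
    using mollifier_exists[OF \<delta>(1)] by blast
  note c\<phi> = bump_algebra_continuous[OF \<phi>(1)]
  define h where "h x = (\<integral>z. \<phi> z * G (x - z) \<partial>lborel)" for x
  define h' where "h' x = (\<integral>z. \<phi> z *\<^sub>R G' (x - z) \<partial>lborel)" for x
  let ?B = "cbox (- \<delta> *\<^sub>R One) (\<delta> *\<^sub>R One) :: (real^'n) set"
  have outB: "\<phi> z = 0" if "z \<notin> ?B" for z
    using cball_subset_cbox_one[of z \<delta>] that by (intro \<phi>(3)) force
  have hB: "h x = integral ?B (\<lambda>z. \<phi> z * G (x - z))" for x
    unfolding h_def
    by (rule integral_cbox_eq_lborel(2))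
       (auto intro!: continuous_intros c\<phi> continuous_on_compose2[OF cG] simp del: scaleR_minus_left simp: outB)
  have h'B: "h' x = integral ?B (\<lambda>z. \<phi> z *\<^sub>R G' (x - z))" for x
    unfolding h'_def
    by (rule integral_cbox_eq_lborel(2))
       (auto intro!: continuous_intros c\<phi> continuous_on_compose2[OF G(2)] simp del: scaleR_minus_left simp: outB)
  have gh: "GDERIV h x :> h' x" for x
    unfolding hB h'B
  proof (rule GDERIV_integral)
    fix x z
    have "((\<lambda>x. G (x - z)) has_derivative (\<lambda>h. h \<bullet> G' (x - z))) (at x)"
      using G(1) unfolding gderiv_def
      by (auto intro!: derivative_eq_intros has_derivative_compose[of "\<lambda>x. x - z" _ x UNIV G])
    then have "GDERIV (\<lambda>x. G (x - z)) x :> G' (x - z)" by (simp add: gderiv_def)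
    from GDERIV_mult[OF GDERIV_const[of "\<phi> z" x] this]
    show "GDERIV (\<lambda>x. \<phi> z * G (x - z)) x :> \<phi> z *\<^sub>R G' (x - z)" by simp
  next
    show "continuous_on UNIV (\<lambda>z. \<phi> z * G (x - z))" for x
      by (intro continuous_intros c\<phi> continuous_on_compose2[OF cG]) auto
    show "continuous_on UNIV (\<lambda>(x, z). \<phi> z *\<^sub>R G' (x - z))"
      unfolding case_prod_beta'
      by (intro continuous_intros continuous_on_compose2[OF c\<phi>] continuous_on_compose2[OF G(2)]) auto
  qed
  have ch': "continuous_on UNIV h'"
  proof -
    have "continuous_on UNIV (\<lambda>x. integral ?B (\<lambda>z. \<phi> z *\<^sub>R G' (x - z)))"
    proof (rule integral_continuous_on_param)
      show "continuous_on (UNIV \<times> ?B) (\<lambda>(x, z). \<phi> z *\<^sub>R G' (x - z))"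
        unfolding case_prod_beta'
        by (intro continuous_intros continuous_on_compose2[OF c\<phi>] continuous_on_compose2[OF G(2)]) auto
    qed
    then show ?thesis by (simp add: h'B[abs_def])
  qed
  have h0: "h x = 0" if "norm x < r / 2 \<or> norm x > R + 1" for x
  proof -
    have "\<phi> z * G (x - z) = 0" for z
    proof (cases "norm z < \<delta>")
      case True
      have "norm x \<le> norm (x - z) + norm z" "norm (x - z) \<le> norm x + norm z"
        using norm_triangle_ineq[of "x - z" z] norm_triangle_ineq4[of x z] by auto
      then have "norm (x - z) < r \<or> norm (x - z) > R" using that True \<delta> by linarith
      then show ?thesis using supp by simp
    qed (use \<phi>(3) in auto)
    then show ?thesis unfolding h_def by (simp only: integral_zero)
  qed
  have "test_fn h"
    unfolding test_fn_def
  proof (intro conjI)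
    let ?C = "cbox (- R *\<^sub>R One) (R *\<^sub>R One) :: (real^'n) set"
    have outC: "G y = 0" if "y \<notin> ?C" for y
      using cball_subset_cbox_one[of y R] that by (intro supp) force
    \<comment> \<open>Substituting \<open>y = x - z\<close> moves the shift onto the kernel, whose
      smoothness then passes to \<open>h\<close>.\<close>
    have "h = (\<lambda>x. integral ?C (\<lambda>y. G y * \<phi> (x - y)))"
    proof
      fix x
      have c: "continuous_on UNIV (\<lambda>y. G y * \<phi> (x - y))"
        by (intro continuous_intros cG continuous_on_compose2[OF c\<phi>]) auto
      have "(\<integral>y. G y * \<phi> (x - y) \<partial>lborel) = h x"
        using lborel_integral_affine[OF borel_measurable_continuous_onI[OF c], of "-1" x]
        by (simp add: h_def mult.commute)
      moreover have "(\<integral>y. G y * \<phi> (x - y) \<partial>lborel) = integral ?C (\<lambda>y. G y * \<phi> (x - y))"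
        by (rule integral_cbox_eq_lborel(2)[OF c]) (simp del: scaleR_minus_left add: outC)
      ultimately show "h x = integral ?C (\<lambda>y. G y * \<phi> (x - y))" by simp
    qed
    then show "smooth_fn h" using smooth_fn_convolution[OF \<phi>(1) cG] by simp
    let ?S = "{x::real^'n. r / 2 \<le> norm x} \<inter> cball 0 (R + 1)"
    have "closed ?S"
      by (intro closed_Int closed_Collect_le continuous_intros closed_cball)
    moreover have "{x. h x \<noteq> 0} \<subseteq> ?S" using h0 by (force simp: not_less)
    ultimately have sub: "closure {x. h x \<noteq> 0} \<subseteq> ?S" by (rule closure_minimal[rotated])
    show "compact (closure {x. h x \<noteq> 0})"
      using sub by (metis bounded_cball bounded_subset closed_closure compact_eq_bounded_closed le_inf_iff)
    show "0 \<notin> closure {x. h x \<noteq> 0}" using sub \<open>r > 0\<close> by auto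
  qed
  moreover have "\<bar>h x - G x\<bar> \<le> e" for x
    using mollification_close[OF c\<phi> \<phi>(2-4) cG, where x=x and e=e] d1(2)[of _ x] \<delta> by (simp add: h_def)
  moreover have "norm (h' x - G' x) \<le> e" for x
    using mollification_close[OF c\<phi> \<phi>(2-4) G(2), where x=x and e=e] d2(2)[of _ x] \<delta> by (simp add: h'_def)
  ultimately show ?thesis using gh ch' h0 by blast
qed

text \<open>The squared positive part is only \<open>C^1\<close>, which suffices for cutoffs because
  truncated functions are mollified afterwards.\<close>

definition sq_pos :: "real \<Rightarrow> real" where "sq_pos t = (max 0 t)\<^sup>2"

lemma sq_pos_DERIV: "(sq_pos has_real_derivative 2 * max 0 t) (at t)"
proof -
  consider "t > 0" | "t < 0" | "t = 0" by linarith
  then show ?thesis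
  proof cases
    case 1
    have "((\<lambda>t. t\<^sup>2) has_real_derivative 2 * max 0 t) (at t)"
      using 1 by (auto intro!: derivative_eq_intros)
    then show ?thesis
      by (rule has_field_derivative_transform_within_open[where S="{0<..}"]) (use 1 in \<open>auto simp: sq_pos_def\<close>)
  next
    case 2
    have "((\<lambda>t. 0) has_real_derivative 2 * max 0 t) (at t)"
      using 2 by (auto intro!: derivative_eq_intros)
    then show ?thesis
      by (rule has_field_derivative_transform_within_open[where S="{..<0}"]) (use 2 in \<open>auto simp: sq_pos_def\<close>)
  next
    case 3
    have "((\<lambda>h. (sq_pos (0 + h) - sq_pos 0) / h) \<longlongrightarrow> 0) (at 0)"
    proof (rule Lim_transform_eventually)
      show "((\<lambda>h::real. max 0 h) \<longlongrightarrow> 0) (at 0)"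
        using tendsto_max[OF tendsto_const[of 0 "at 0"] tendsto_ident_at[of 0 UNIV]] by simp
      show "\<forall>\<^sub>F h in at 0. max 0 h = (sq_pos (0 + h) - sq_pos 0) / h"
        by (auto simp: eventually_at_filter sq_pos_def max_def power2_eq_square)
    qed
    then show ?thesis by (simp add: 3 DERIV_def)
  qed
qed

text \<open>A \<open>C\<^sup>1\<close> step function: \<open>0\<close> on \<open>(-\<infinity>, 1]\<close> and \<open>1\<close> on \<open>[2, \<infinity>)\<close>.\<close>

definition step :: "real \<Rightarrow> real" where
  "step t = 1 - sq_pos (1 - sq_pos (t - 1))"

definition step' :: "real \<Rightarrow> real" where
  "step' t = 4 * max 0 (1 - sq_pos (t - 1)) * max 0 (t - 1)"

lemma step_DERIV: "(step has_real_derivative step' t) (at t)"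
proof -
  have 1: "((\<lambda>t. sq_pos (t - 1)) has_real_derivative 2 * max 0 (t - 1)) (at t)"
    using DERIV_shift[of sq_pos "2 * max 0 (t - 1)" t "- 1"] sq_pos_DERIV[of "t - 1"] by simp
  have 2: "((\<lambda>t. 1 - sq_pos (t - 1)) has_real_derivative - (2 * max 0 (t - 1))) (at t)"
    using DERIV_diff[OF DERIV_const[of 1] 1] by simp
  have "((\<lambda>t. sq_pos (1 - sq_pos (t - 1))) has_real_derivative
      2 * max 0 (1 - sq_pos (t - 1)) * - (2 * max 0 (t - 1))) (at t)"
    by (rule DERIV_chain2[OF sq_pos_DERIV 2])
  from DERIV_diff[OF DERIV_const[of 1] this] show ?thesis
    by (simp add: step_def[abs_def] step'_def mult.assoc)
qed

lemma step_bounds: "0 \<le> step t" "step t \<le> 1"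
proof -
  have "max 0 (1 - sq_pos (t - 1)) \<le> 1" by (simp add: sq_pos_def)
  then have "sq_pos (1 - sq_pos (t - 1)) \<le> 1"
    unfolding sq_pos_def[of "1 - sq_pos (t - 1)"] by (rule power_le_one[rotated]) simp
  then show "0 \<le> step t" "step t \<le> 1" by (auto simp: step_def) (simp add: sq_pos_def)
qed

lemma step_eq_0: "t \<le> 1 \<Longrightarrow> step t = 0"
  by (simp add: step_def sq_pos_def)

lemma sq_pos_ge_1: "t \<ge> 2 \<Longrightarrow> sq_pos (t - 1) \<ge> 1"
  by (simp add: sq_pos_def one_le_power)

lemma step_eq_1: "t \<ge> 2 \<Longrightarrow> step t = 1"
  using sq_pos_ge_1[of t] by (simp add: step_def sq_pos_def[of "1 - _"])

lemma step'_eq_0: "t \<le> 1 \<or> t \<ge> 2 \<Longrightarrow> step' t = 0"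
  using sq_pos_ge_1[of t] by (auto simp: step'_def)

lemma step'_bounds: "0 \<le> step' t" "step' t \<le> 4"
proof -
  show "0 \<le> step' t" by (simp add: step'_def)
  show "step' t \<le> 4"
  proof (cases "t \<ge> 2")
    case False
    have "max 0 (1 - sq_pos (t - 1)) * max 0 (t - 1) \<le> 1 * 1"
      using False by (intro mult_mono) (auto simp: sq_pos_def)
    then show ?thesis by (simp add: step'_def)
  qed (simp add: step'_eq_0)
qed

lemma continuous_step': "continuous_on UNIV step'"
  unfolding step'_def[abs_def] sq_pos_def by (intro continuous_intros)

lemma GDERIV_radial_step:
  "GDERIV (\<lambda>x. step (s * (x \<bullet> x))) x :> (2 * s * step' (s * (x \<bullet> x))) *\<^sub>R x"
proof -
  have "GDERIV (\<lambda>x. s * (x \<bullet> x)) x :> (2 * s) *\<^sub>R x"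
    unfolding gderiv_def by (auto intro!: derivative_eq_intros simp: inner_commute algebra_simps)
  from GDERIV_DERIV_compose[OF this step_DERIV] show ?thesis by (simp add: mult.commute)
qed

text \<open>\<open>step'\<close> lives where \<open>1 \<le> s |x|^2 \<le> 2\<close>, so there
  \<open>|x|^2\<close> is comparable to \<open>1 / s\<close>. Hence the radial derivative of the
  cutoff is bounded uniformly in \<open>s\<close>, while its squared gradient is of order
  \<open>s\<close>. The numbers come from \<open>step' \<le> 4\<close>.\<close>

lemma radial_step_gradient_bounds:
  fixes x :: "'a::real_inner"
  assumes "s > 0"
  shows "\<bar>2 * s * step' (s * (x \<bullet> x))\<bar> * (x \<bullet> x) \<le> 16"
    and "(norm ((2 * s * step' (s * (x \<bullet> x))) *\<^sub>R x))\<^sup>2 \<le> 128 * s"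
proof -
  let ?t = "s * (x \<bullet> x)"
  have t: "step' ?t * ?t \<le> 8" "(step' ?t)\<^sup>2 * ?t \<le> 32"
  proof -
    have "step' ?t * ?t \<le> 4 * 2 \<and> (step' ?t)\<^sup>2 * ?t \<le> 4\<^sup>2 * 2" if "?t < 2"
      using that step'_bounds[of ?t] assms by (intro conjI mult_mono power_mono) auto
    then show "step' ?t * ?t \<le> 8" "(step' ?t)\<^sup>2 * ?t \<le> 32"
      using step'_eq_0[of ?t] by (cases "?t < 2"; force)+
  qed
  show "\<bar>2 * s * step' ?t\<bar> * (x \<bullet> x) \<le> 16"
    using t(1) assms step'_bounds[of ?t] by (simp add: abs_mult mult_ac)
  have "(norm ((2 * s * step' ?t) *\<^sub>R x))\<^sup>2 = 4 * s * ((step' ?t)\<^sup>2 * ?t)"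
    by (simp add: power_mult_distrib power2_norm_eq_inner) (simp add: power2_eq_square)
  also have "\<dots> \<le> 4 * s * 32" using t(2) assms by (intro mult_left_mono) auto
  finally show "(norm ((2 * s * step' ?t) *\<^sub>R x))\<^sup>2 \<le> 128 * s" by simp
qed

section \<open>Weighted quadratic inequalities beyond test functions\<close>

lemma integrable_dominated:
  fixes f :: "'a::euclidean_space \<Rightarrow> real"
  assumes "integrable lborel g" "continuous_on UNIV f" "\<And>x. \<bar>f x\<bar> \<le> g x"
  shows "integrable lborel f"
  using assms by (intro Bochner_Integration.integrable_bound[OF assms(1)])
    (auto intro!: borel_measurable_continuous_onI AE_I2 intro: order.trans[OF _ abs_ge_self])

lemma integrable_indicator_cball_mult:
  fixes f :: "'a::euclidean_space \<Rightarrow> real"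
  assumes "continuous_on UNIV f"
  shows "integrable lborel (\<lambda>x. indicator (cball 0 R) x * f x)"
  using borel_integrable_compact[of "cball 0 R" f] continuous_on_subset[OF assms] by simp

text \<open>Uniform approximation of function and gradient by mollification. The variance is kept in
  the expanded form with \<open>\<kappa>\<close>, so that just three integrals have to pass to the
  limit.\<close>

lemma quadratic_inequality_C1_compact:
  fixes G :: "real^'n \<Rightarrow> real"
  assumes cont: "continuous_on UNIV v" "continuous_on UNIV u"
    and nonneg: "\<And>x. v x \<ge> 0" "\<And>x. u x \<ge> 0"
    and test: "\<And>h :: real^'n \<Rightarrow> real. test_fn h \<Longrightarrow>
       \<Lambda> * ((\<integral>x. (h x)\<^sup>2 * u x \<partial>lborel) - \<kappa> * (\<integral>x. h x * u x \<partial>lborel)\<^sup>2)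
         \<le> (\<integral>x. (norm (grad h x))\<^sup>2 * v x \<partial>lborel)"
    and G: "\<And>x. GDERIV G x :> G' x" "continuous_on UNIV G'"
    and supp: "\<And>x. norm x < r \<or> norm x > R \<Longrightarrow> G x = 0" and "r > 0"
  shows "\<Lambda> * ((\<integral>x. (G x)\<^sup>2 * u x \<partial>lborel) - \<kappa> * (\<integral>x. G x * u x \<partial>lborel)\<^sup>2)
         \<le> (\<integral>x. (norm (G' x))\<^sup>2 * v x \<partial>lborel)"
proof -
  note cG = GDERIV_imp_continuous_on[OF G(1)]
  define \<epsilon> where "\<epsilon> k = 1 / real (Suc k)" for k
  have \<epsilon>: "\<epsilon> k > 0" "\<epsilon> k \<le> 1" "\<epsilon> \<longlonglongrightarrow> 0" for k
    using LIMSEQ_Suc[OF lim_1_over_n[where 'a=real]] unfolding \<epsilon>_def[abs_def] by auto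
  have "\<forall>k. \<exists>h h'. test_fn h \<and> (\<forall>x. GDERIV h x :> h' x) \<and> continuous_on UNIV h'
    \<and> (\<forall>x. \<bar>h x - G x\<bar> \<le> \<epsilon> k) \<and> (\<forall>x. norm (h' x - G' x) \<le> \<epsilon> k) \<and> (\<forall>x. norm x > R + 1 \<longrightarrow> h x = 0)"
    using test_fn_approximation[OF G supp \<open>r > 0\<close> \<epsilon>(1)] by blast
  then obtain h h' where h: "\<And>k. test_fn (h k)" "\<And>k x. GDERIV (h k) x :> h' k x"
    "\<And>k. continuous_on UNIV (h' k)" "\<And>k x. \<bar>h k x - G x\<bar> \<le> \<epsilon> k"
    "\<And>k x. norm (h' k x - G' x) \<le> \<epsilon> k" "\<And>k x. norm x > R + 1 \<Longrightarrow> h k x = 0"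
    by metis
  have h'0: "h' k x = 0" if "norm x > R + 1" for k x
  proof (rule GDERIV_eq_0[OF h(2), where S="{x. norm x > R + 1}"])
    show "open {x::real^'n. norm x > R + 1}" by (intro open_Collect_less continuous_intros)
  qed (use h(6) that in auto)
  have ch: "continuous_on UNIV (h k)" for k by (rule GDERIV_imp_continuous_on[OF h(2)])
  have lim: "(\<lambda>k. h k x) \<longlonglongrightarrow> G x" "(\<lambda>k. h' k x) \<longlonglongrightarrow> G' x" for x
  proof -
    show "(\<lambda>k. h k x) \<longlonglongrightarrow> G x"
      using h(4) by (intro LIM_zero_cancel[OF Lim_null_comparison[OF _ \<epsilon>(3)]]) auto
    show "(\<lambda>k. h' k x) \<longlonglongrightarrow> G' x"
      using h(5) by (intro LIM_zero_cancel[OF Lim_null_comparison[OF _ \<epsilon>(3)]]) auto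
  qed
  have hb: "\<bar>h k x\<bar> \<le> \<bar>G x\<bar> + 1" "norm (h' k x) \<le> norm (G' x) + 1" for k x
    using h(4)[of k x] h(5)[of k x] \<epsilon>(2)[of k] norm_triangle_ineq2[of "h' k x" "G' x"] by linarith+
  \<comment> \<open>All approximants vanish outside this ball and stay within 1 of their limits, so
    fixed continuous functions restricted to the ball dominate the three integrands.\<close>
  let ?I = "\<lambda>x. indicator (cball 0 (R + 1)) x :: real"
  have L1: "(\<lambda>k. \<integral>x. (h k x)\<^sup>2 * u x \<partial>lborel) \<longlonglongrightarrow> (\<integral>x. (G x)\<^sup>2 * u x \<partial>lborel)"
  proof (rule integral_dominated_convergence)
    show "integrable lborel (\<lambda>x. ?I x * ((\<bar>G x\<bar> + 1)\<^sup>2 * u x))"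
      by (intro integrable_indicator_cball_mult continuous_intros cG cont)
    show "AE x in lborel. norm ((h k x)\<^sup>2 * u x) \<le> ?I x * ((\<bar>G x\<bar> + 1)\<^sup>2 * u x)" for k
    proof (rule AE_I2)
      fix x
      show "norm ((h k x)\<^sup>2 * u x) \<le> ?I x * ((\<bar>G x\<bar> + 1)\<^sup>2 * u x)"
      proof (cases "norm x > R + 1")
        case False
        have "(h k x)\<^sup>2 \<le> (\<bar>G x\<bar> + 1)\<^sup>2" using power_mono[OF hb(1)[of k x], of 2] by simp
        with False show ?thesis
          using nonneg by (auto simp: indicator_def abs_mult intro!: mult_right_mono)
      qed (use h(6) in auto)
    qed
  qed (auto intro!: AE_I2 tendsto_intros lim borel_measurable_continuous_onI continuous_intros ch cG cont)
  have L2: "(\<lambda>k. \<integral>x. h k x * u x \<partial>lborel) \<longlonglongrightarrow> (\<integral>x. G x * u x \<partial>lborel)"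
  proof (rule integral_dominated_convergence)
    show "integrable lborel (\<lambda>x. ?I x * ((\<bar>G x\<bar> + 1) * u x))"
      by (intro integrable_indicator_cball_mult continuous_intros cG cont)
    show "AE x in lborel. norm (h k x * u x) \<le> ?I x * ((\<bar>G x\<bar> + 1) * u x)" for k
    proof (rule AE_I2)
      fix x
      show "norm (h k x * u x) \<le> ?I x * ((\<bar>G x\<bar> + 1) * u x)"
      proof (cases "norm x > R + 1")
        case False
        then show ?thesis
          using nonneg hb(1)[of k x] by (auto simp: indicator_def abs_mult intro!: mult_right_mono)
      qed (use h(6) in auto)
    qed
  qed (auto intro!: AE_I2 tendsto_intros lim borel_measurable_continuous_onI continuous_intros ch cG cont)
  have L3: "(\<lambda>k. \<integral>x. (norm (h' k x))\<^sup>2 * v x \<partial>lborel) \<longlonglongrightarrow> (\<integral>x. (norm (G' x))\<^sup>2 * v x \<partial>lborel)"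
  proof (rule integral_dominated_convergence)
    show "integrable lborel (\<lambda>x. ?I x * ((norm (G' x) + 1)\<^sup>2 * v x))"
      by (intro integrable_indicator_cball_mult continuous_intros G cont)
    show "AE x in lborel. norm ((norm (h' k x))\<^sup>2 * v x) \<le> ?I x * ((norm (G' x) + 1)\<^sup>2 * v x)" for k
    proof (rule AE_I2)
      fix x
      show "norm ((norm (h' k x))\<^sup>2 * v x) \<le> ?I x * ((norm (G' x) + 1)\<^sup>2 * v x)"
      proof (cases "norm x > R + 1")
        case False
        have "(norm (h' k x))\<^sup>2 \<le> (norm (G' x) + 1)\<^sup>2" using power_mono[OF hb(2)[of k x], of 2] by simp
        with False show ?thesis
          using nonneg by (auto simp: indicator_def abs_mult intro!: mult_right_mono)
      qed (use h'0 in auto)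
    qed
  qed (auto intro!: AE_I2 tendsto_intros lim borel_measurable_continuous_onI continuous_intros h(3) G(2) cont)
  have "\<Lambda> * ((\<integral>x. (h k x)\<^sup>2 * u x \<partial>lborel) - \<kappa> * (\<integral>x. h k x * u x \<partial>lborel)\<^sup>2)
         \<le> (\<integral>x. (norm (h' k x))\<^sup>2 * v x \<partial>lborel)" for k
    using test[OF h(1)[of k]] grad_eq[OF h(2)] by simp
  moreover have "(\<lambda>k. \<Lambda> * ((\<integral>x. (h k x)\<^sup>2 * u x \<partial>lborel) - \<kappa> * (\<integral>x. h k x * u x \<partial>lborel)\<^sup>2))
      \<longlonglongrightarrow> \<Lambda> * ((\<integral>x. (G x)\<^sup>2 * u x \<partial>lborel) - \<kappa> * (\<integral>x. G x * u x \<partial>lborel)\<^sup>2)"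
    by (intro tendsto_intros L1 L2)
  ultimately show ?thesis
    by (intro LIMSEQ_le[OF _ L3]) auto
qed

text \<open>Switches on between the radii \<open>1 / n\<close> and \<open>sqrt 2 / n\<close>, and
  off between \<open>n\<close> and \<open>sqrt 2 * n\<close>.\<close>

definition annulus_cutoff :: "real \<Rightarrow> 'a::real_inner \<Rightarrow> real" where
  "annulus_cutoff n x = step (n\<^sup>2 * (x \<bullet> x)) * (1 - step (inverse (n\<^sup>2) * (x \<bullet> x)))"

definition annulus_cutoff' :: "real \<Rightarrow> 'a::real_inner \<Rightarrow> 'a" where
  "annulus_cutoff' n x = step (n\<^sup>2 * (x \<bullet> x)) *\<^sub>R (- ((2 * inverse (n\<^sup>2) * step' (inverse (n\<^sup>2) * (x \<bullet> x))) *\<^sub>R x))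
     + (1 - step (inverse (n\<^sup>2) * (x \<bullet> x))) *\<^sub>R ((2 * n\<^sup>2 * step' (n\<^sup>2 * (x \<bullet> x))) *\<^sub>R x)"

lemma GDERIV_annulus_cutoff: "GDERIV (annulus_cutoff n) x :> annulus_cutoff' n x"
  unfolding annulus_cutoff_def[abs_def] annulus_cutoff'_def
  using GDERIV_mult[OF GDERIV_radial_step[of "n\<^sup>2" x]
      GDERIV_diff[OF GDERIV_const[of 1 x] GDERIV_radial_step[of "inverse (n\<^sup>2)" x]]]
  by simp

lemma continuous_step: "continuous_on UNIV step"
  by (auto intro!: continuous_at_imp_continuous_on DERIV_isCont step_DERIV)

lemma continuous_annulus_cutoff': "continuous_on UNIV (annulus_cutoff' n)"
  unfolding annulus_cutoff'_def[abs_def]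
  by (intro continuous_intros continuous_on_compose2[OF continuous_step] continuous_on_compose2[OF continuous_step']) auto

lemma annulus_cutoff_bounds: "0 \<le> annulus_cutoff n x" "annulus_cutoff n x \<le> 1"
  using step_bounds by (auto simp: annulus_cutoff_def intro!: mult_le_one)

lemma annulus_cutoff_support:
  assumes "n > 0" "norm x < 1 / n \<or> norm x > 2 * n"
  shows "annulus_cutoff n x = 0"
  using assms(2)
proof
  assume "norm x < 1 / n"
  then have "(norm x * n)\<^sup>2 \<le> 1" using assms(1) by (intro power_le_one) (auto simp: field_simps)
  then have "n\<^sup>2 * (x \<bullet> x) \<le> 1" by (simp add: power_mult_distrib power2_norm_eq_inner mult.commute)
  then show ?thesis by (simp add: annulus_cutoff_def step_eq_0)
next
  assume "norm x > 2 * n"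
  then have "(2 * n)\<^sup>2 \<le> (norm x)\<^sup>2" using assms(1) by (intro power_mono) auto
  then have "4 * n\<^sup>2 \<le> x \<bullet> x" unfolding power2_norm_eq_inner by (simp add: power_mult_distrib)
  then have "2 * n\<^sup>2 \<le> x \<bullet> x" using zero_le_power2[of n] by linarith
  then have "inverse (n\<^sup>2) * (x \<bullet> x) \<ge> 2" using assms(1) by (simp add: field_simps)
  then show ?thesis by (simp add: annulus_cutoff_def step_eq_1)
qed

lemma annulus_cutoff_tendsto:
  assumes "x \<noteq> 0"
  shows "(\<lambda>k. annulus_cutoff (real (Suc k)) x) \<longlonglongrightarrow> 1"
proof (rule tendsto_eventually)
  obtain N :: nat where N: "real N \<ge> max (norm x) (2 / norm x)" using real_arch_simple by blast
  show "\<forall>\<^sub>F k in sequentially. annulus_cutoff (real (Suc k)) x = 1"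
    using eventually_ge_at_top[of N]
  proof eventually_elim
    case (elim k)
    let ?n = "real (Suc k)"
    have n: "?n \<ge> norm x" "?n \<ge> 2 / norm x" "?n > 0" using elim N by auto
    have "(norm x)\<^sup>2 \<le> ?n\<^sup>2" using n by (intro power_mono) auto
    then have "inverse (?n\<^sup>2) * (x \<bullet> x) \<le> 1" using n(3) by (simp add: field_simps power2_norm_eq_inner)
    moreover have "2\<^sup>2 \<le> (?n * norm x)\<^sup>2" using n assms by (intro power_mono) (auto simp: field_simps)
    then have "?n\<^sup>2 * (x \<bullet> x) \<ge> 2" unfolding power_mult_distrib power2_norm_eq_inner by simp
    ultimately show ?case by (simp add: annulus_cutoff_def step_eq_0 step_eq_1)
  qed
qed

text \<open>The gradient has size \<open>1 / |x|\<close> at the outer edge and \<open>n\<close> at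
  the inner one. After multiplication by \<open>|x|^2\<close> the outer part is bounded, which is
  the form that a growth condition \<open>v \<le> K |x|^2 u\<close> can absorb; the inner part sits
  on a ball of shrinking volume. The constants are \<open>256 = 2 * 128\<close> and
  \<open>512 = 2 * 16^2\<close>.\<close>

lemma annulus_cutoff_gradient_bound:
  fixes x :: "'a::real_inner"
  assumes "n > 0"
  shows "(norm (annulus_cutoff' n x))\<^sup>2 * (x \<bullet> x)
     \<le> 256 * n\<^sup>2 * (x \<bullet> x) * indicator (cball 0 (2 / n)) x + 512 * indicator {x. norm x \<ge> n} x"
proof -
  let ?a = "- ((2 * inverse (n\<^sup>2) * step' (inverse (n\<^sup>2) * (x \<bullet> x))) *\<^sub>R x)"
  let ?b = "(2 * n\<^sup>2 * step' (n\<^sup>2 * (x \<bullet> x))) *\<^sub>R x"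
  have "norm (annulus_cutoff' n x) \<le> norm ?a + norm ?b"
  proof -
    have contract: "norm (c *\<^sub>R y) \<le> norm y" if "0 \<le> c" "c \<le> 1" for c and y :: 'a
      using that by (simp add: mult_left_le_one_le)
    have "norm (annulus_cutoff' n x) \<le> norm (step (n\<^sup>2 * (x \<bullet> x)) *\<^sub>R ?a) + norm ((1 - step (inverse (n\<^sup>2) * (x \<bullet> x))) *\<^sub>R ?b)"
      unfolding annulus_cutoff'_def by (rule norm_triangle_ineq)
    also have "\<dots> \<le> norm ?a + norm ?b"
      using step_bounds by (intro add_mono contract) auto
    finally show ?thesis .
  qed
  then have "(norm (annulus_cutoff' n x))\<^sup>2 \<le> (norm ?a + norm ?b)\<^sup>2" by (rule power_mono) simp
  also have "\<dots> \<le> 2 * (norm ?a)\<^sup>2 + 2 * (norm ?b)\<^sup>2"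
    using sum_squares_bound[of "norm ?a" "norm ?b"] by (simp add: power2_sum)
  finally have *: "(norm (annulus_cutoff' n x))\<^sup>2 * (x \<bullet> x) \<le> 2 * (norm ?a)\<^sup>2 * (x \<bullet> x) + 2 * (norm ?b)\<^sup>2 * (x \<bullet> x)"
    using mult_right_mono[of _ _ "x \<bullet> x"] by (fastforce simp: algebra_simps)
  have a: "(norm ?a)\<^sup>2 * (x \<bullet> x) \<le> 256 * indicator {x. norm x \<ge> n} x"
  proof (cases "norm x \<ge> n")
    case True
    have "(norm ?a)\<^sup>2 * (x \<bullet> x) = (\<bar>2 * inverse (n\<^sup>2) * step' (inverse (n\<^sup>2) * (x \<bullet> x))\<bar> * (x \<bullet> x))\<^sup>2"
      by (simp only: norm_minus_cancel norm_scaleR power_mult_distrib power2_norm_eq_inner power2_eq_square[of "x \<bullet> x"] mult.assoc)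
    also have "\<dots> \<le> 16\<^sup>2"
      using radial_step_gradient_bounds(1)[of "inverse (n\<^sup>2)" x] assms by (intro power_mono) auto
    finally show ?thesis using True by simp
  next
    case False
    then have "(norm x)\<^sup>2 \<le> n\<^sup>2" by (intro power_mono) auto
    then have "inverse (n\<^sup>2) * (x \<bullet> x) \<le> 1" using assms by (simp add: field_simps power2_norm_eq_inner)
    then show ?thesis by (simp add: step'_eq_0)
  qed
  have b: "(norm ?b)\<^sup>2 \<le> 128 * n\<^sup>2 * indicator (cball 0 (2 / n)) x"
  proof (cases "norm x \<le> 2 / n")
    case True
    then show ?thesis using radial_step_gradient_bounds(2)[of "n\<^sup>2" x] assms by simp
  next
    case False
    then have "2\<^sup>2 \<le> (n * norm x)\<^sup>2" using assms by (intro power_mono) (auto simp: field_simps)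
    then have "n\<^sup>2 * (x \<bullet> x) \<ge> 2" unfolding power_mult_distrib power2_norm_eq_inner by simp
    then show ?thesis by (simp add: step'_eq_0)
  qed
  have "2 * (norm ?b)\<^sup>2 * (x \<bullet> x) \<le> 256 * n\<^sup>2 * indicator (cball 0 (2 / n)) x * (x \<bullet> x)"
    using b by (intro mult_right_mono) auto
  with * a show ?thesis by (simp add: mult_ac)
qed

text \<open>Expand \<open>|\<delta> a - b|^2 / \<delta> \<ge> 0\<close>. The free parameter keeps
  the factor of the main term arbitrarily close to 1, so that the spectral constant survives the
  cutoff undamaged.\<close>

lemma norm_add_squared_le:
  fixes a b :: "'a::real_inner"
  assumes "\<delta> > 0"
  shows "(norm (a + b))\<^sup>2 \<le> (1 + \<delta>) * (norm a)\<^sup>2 + (1 + 1 / \<delta>) * (norm b)\<^sup>2"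
proof -
  have "0 \<le> (norm (\<delta> *\<^sub>R a - b))\<^sup>2 / \<delta>" using assms by simp
  also have "\<dots> = \<delta> * (a \<bullet> a) - 2 * (a \<bullet> b) + (b \<bullet> b) / \<delta>"
    using assms by (simp add: power2_norm_eq_inner inner_diff inner_commute field_simps)
  finally show ?thesis
    using assms by (simp add: power2_norm_eq_inner inner_add inner_commute field_simps)
qed

text \<open>In dimension at least three points have zero capacity, so excluding a neighbourhood
  of the origin from the supports costs nothing.\<close>

lemma quadratic_inequality_bounded:
  fixes g :: "real^'n \<Rightarrow> real"
  assumes dim: "CARD('n) \<ge> 3"
    and cont: "continuous_on UNIV v" "continuous_on UNIV u"
    and nonneg: "\<And>x. v x \<ge> 0" "\<And>x. u x \<ge> 0"
    and test: "\<And>h :: real^'n \<Rightarrow> real. test_fn h \<Longrightarrow>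
       \<Lambda> * ((\<integral>x. (h x)\<^sup>2 * u x \<partial>lborel) - \<kappa> * (\<integral>x. h x * u x \<partial>lborel)\<^sup>2)
         \<le> (\<integral>x. (norm (grad h x))\<^sup>2 * v x \<partial>lborel)"
    and growth: "\<And>x. norm x \<ge> 1 \<Longrightarrow> v x \<le> K * (x \<bullet> x) * u x"
    and g: "\<And>x. GDERIV g x :> g' x" "continuous_on UNIV g'" "\<And>x. \<bar>g x\<bar> \<le> M"
    and i1: "integrable lborel (\<lambda>x. (g x)\<^sup>2 * u x)"
    and i2: "integrable lborel (\<lambda>x. (norm (g' x))\<^sup>2 * v x)"
    and mean: "\<kappa> = 0 \<or> integrable lborel (\<lambda>x. g x * u x) \<and> (\<integral>x. g x * u x \<partial>lborel) = 0"
  shows "\<Lambda> * (\<integral>x. (g x)\<^sup>2 * u x \<partial>lborel) \<le> (\<integral>x. (norm (g' x))\<^sup>2 * v x \<partial>lborel)"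
proof -
  note cg = GDERIV_imp_continuous_on[OF g(1)]
  define n where "n k = real (Suc k)" for k
  have n: "n k > 0" "n k \<ge> 1" for k by (auto simp: n_def)
  define C where "C k = (annulus_cutoff (n k) :: real^'n \<Rightarrow> real)" for k
  define C' where "C' k = (annulus_cutoff' (n k) :: real^'n \<Rightarrow> real^'n)" for k
  have C: "GDERIV (C k) x :> C' k x" "continuous_on UNIV (C' k)" "0 \<le> C k x" "C k x \<le> 1" for k x
    unfolding C_def C'_def
    by (simp_all add: GDERIV_annulus_cutoff continuous_annulus_cutoff' annulus_cutoff_bounds)
  have cC: "continuous_on UNIV (C k)" for k by (rule GDERIV_imp_continuous_on[OF C(1)])
  \<comment> \<open>Every cutoff vanishes at the origin, so the convergence is only almost
    everywhere.\<close>
  have limC: "AE x in lborel. (\<lambda>k. C k x) \<longlonglongrightarrow> 1"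
    using AE_lborel_singleton[of "0::real^'n"]
  proof eventually_elim
    case (elim x)
    then show ?case unfolding C_def n_def using annulus_cutoff_tendsto[of x] by auto
  qed
  have Cabs: "\<bar>C k x\<bar> \<le> 1" "(C k x)\<^sup>2 \<le> 1" for k x
    using C(3,4)[of k x] by (auto intro: power_le_one)
  have L1: "(\<lambda>k. \<integral>x. (g x * C k x)\<^sup>2 * u x \<partial>lborel) \<longlonglongrightarrow> (\<integral>x. (g x)\<^sup>2 * u x \<partial>lborel)"
  proof (rule integral_dominated_convergence[OF _ _ i1])
    show "AE x in lborel. (\<lambda>k. (g x * C k x)\<^sup>2 * u x) \<longlonglongrightarrow> (g x)\<^sup>2 * u x"
      using limC
    proof eventually_elim
      case (elim x)
      then have "(\<lambda>k. (g x * C k x)\<^sup>2 * u x) \<longlonglongrightarrow> (g x * 1)\<^sup>2 * u x" by (intro tendsto_intros)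
      then show ?case by simp
    qed
    show "AE x in lborel. norm ((g x * C k x)\<^sup>2 * u x) \<le> (g x)\<^sup>2 * u x" for k
    proof (rule AE_I2)
      fix x
      have "(C k x)\<^sup>2 * ((g x)\<^sup>2 * u x) \<le> 1 * ((g x)\<^sup>2 * u x)"
        using Cabs(2) nonneg by (intro mult_right_mono) auto
      then show "norm ((g x * C k x)\<^sup>2 * u x) \<le> (g x)\<^sup>2 * u x"
        using nonneg by (simp add: power_mult_distrib mult_ac)
    qed
  qed (auto intro!: borel_measurable_continuous_onI continuous_intros cg cC cont)
  have L2: "(\<lambda>k. \<kappa> * (\<integral>x. (g x * C k x) * u x \<partial>lborel)\<^sup>2) \<longlonglongrightarrow> 0"
  proof (cases "\<kappa> = 0")
    case False
    with mean have i: "integrable lborel (\<lambda>x. g x * u x)" and z: "(\<integral>x. g x * u x \<partial>lborel) = 0" by auto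
    have "(\<lambda>k. \<integral>x. (g x * C k x) * u x \<partial>lborel) \<longlonglongrightarrow> (\<integral>x. g x * u x \<partial>lborel)"
    proof (rule integral_dominated_convergence[where w="\<lambda>x. \<bar>g x * u x\<bar>"])
      show "AE x in lborel. (\<lambda>k. (g x * C k x) * u x) \<longlonglongrightarrow> g x * u x"
        using limC
      proof eventually_elim
        case (elim x)
        then have "(\<lambda>k. (g x * C k x) * u x) \<longlonglongrightarrow> (g x * 1) * u x" by (intro tendsto_intros)
        then show ?case by simp
      qed
      show "AE x in lborel. norm ((g x * C k x) * u x) \<le> \<bar>g x * u x\<bar>" for k
      proof (rule AE_I2)
        fix x
        have "\<bar>C k x\<bar> * \<bar>g x * u x\<bar> \<le> 1 * \<bar>g x * u x\<bar>"
          using Cabs(1) by (intro mult_right_mono) auto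
        then show "norm ((g x * C k x) * u x) \<le> \<bar>g x * u x\<bar>"
          by (simp add: abs_mult mult_ac)
      qed
    qed (use i in \<open>auto intro!: borel_measurable_continuous_onI continuous_intros cg cC cont\<close>)
    then have "(\<lambda>k. \<kappa> * (\<integral>x. (g x * C k x) * u x \<partial>lborel)\<^sup>2) \<longlonglongrightarrow> \<kappa> * 0\<^sup>2"
      unfolding z by (intro tendsto_intros)
    then show ?thesis by simp
  qed simp
  \<comment> \<open>The error of the cutoff: the part of the gradient of \<open>g C\<close> in which
    the derivative falls on \<open>C\<close>.\<close>
  define E where "E k x = (g x)\<^sup>2 * (norm (C' k x))\<^sup>2 * v x" for k x
  have cE: "continuous_on UNIV (E k)" for k
    unfolding E_def by (intro continuous_intros cg C cont)
  have "bounded (v ` cball 0 2)"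
    by (intro compact_imp_bounded compact_continuous_image continuous_on_subset[OF cont(1)]) auto
  then obtain B where B: "\<And>x. norm x \<le> 2 \<Longrightarrow> v x \<le> B"
    unfolding bounded_iff by (force simp: abs_le_iff)
  define T where "T k x = (g x)\<^sup>2 * u x * indicator {x. norm x \<ge> n k} x" for k x
  \<comment> \<open>The first term bounds the error near the origin, with \<open>g\<close> and
    \<open>v\<close> replaced by \<open>M\<close> and \<open>B\<close>. The second is a tail of the
    integrable function \<open>g^2 u\<close>, obtained from the outer gradient bound and
    \<open>growth\<close>.\<close>
  define S where "S k x = 256 * M\<^sup>2 * B * (n k)\<^sup>2 * indicator (cball 0 (2 / n k)) x + 512 * K * T k x" for k x
  have E0: "0 \<le> E k x" for k x by (simp add: E_def nonneg)
  have B0: "B \<ge> 0" using B[of 0] nonneg(1)[of 0] by simp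
  have M0: "(g x)\<^sup>2 \<le> M\<^sup>2" for x using power_mono[OF g(3)[of x], of 2] by simp
  have ES: "E k x \<le> S k x" for k x
  proof (cases "x = 0")
    case True
    then show ?thesis using B0 n[of k] by (simp add: E_def C'_def annulus_cutoff'_def S_def T_def)
  next
    case False
    then have xx: "x \<bullet> x > 0" by simp
    have "(norm (C' k x))\<^sup>2 \<le> (256 * (n k)\<^sup>2 * (x \<bullet> x) * indicator (cball 0 (2 / n k)) x + 512 * indicator {x. norm x \<ge> n k} x) / (x \<bullet> x)"
      using annulus_cutoff_gradient_bound[OF n(1), of k x] xx unfolding C'_def by (simp add: pos_le_divide_eq)
    also have "\<dots> = 256 * (n k)\<^sup>2 * indicator (cball 0 (2 / n k)) x + 512 / (x \<bullet> x) * indicator {x. norm x \<ge> n k} x"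
      using xx by (simp add: field_simps)
    finally have "E k x \<le> (g x)\<^sup>2 * (256 * (n k)\<^sup>2 * indicator (cball 0 (2 / n k)) x + 512 / (x \<bullet> x) * indicator {x. norm x \<ge> n k} x) * v x"
      unfolding E_def by (intro mult_right_mono mult_left_mono nonneg) auto
    also have "\<dots> = 256 * (n k)\<^sup>2 * ((g x)\<^sup>2 * v x * indicator (cball 0 (2 / n k)) x)
        + 512 * (g x)\<^sup>2 * (v x / (x \<bullet> x) * indicator {x. norm x \<ge> n k} x)"
      by (simp add: algebra_simps)
    also have "\<dots> \<le> 256 * (n k)\<^sup>2 * (M\<^sup>2 * B * indicator (cball 0 (2 / n k)) x)
        + 512 * (g x)\<^sup>2 * (K * u x * indicator {x. norm x \<ge> n k} x)"
    proof (intro add_mono mult_left_mono)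
      show "(g x)\<^sup>2 * v x * indicator (cball 0 (2 / n k)) x \<le> M\<^sup>2 * B * indicator (cball 0 (2 / n k)) x"
      proof (cases "norm x \<le> 2 / n k")
        case True
        also have "2 / n k \<le> 2" using n[of k] by (simp add: field_simps)
        finally have "v x \<le> B" by (rule B)
        then show ?thesis using M0[of x] nonneg B0 by (intro mult_right_mono mult_mono) auto
      qed simp
      show "v x / (x \<bullet> x) * indicator {x. norm x \<ge> n k} x \<le> K * u x * indicator {x. norm x \<ge> n k} x"
      proof (cases "norm x \<ge> n k")
        case True
        with n(2)[of k] have "norm x \<ge> 1" by linarith
        with growth[of x] xx show ?thesis by (intro mult_right_mono) (auto simp: field_simps)
      qed simp
    qed auto
    also have "\<dots> = S k x" by (simp add: S_def T_def algebra_simps)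
    finally show ?thesis .
  qed
  have iT: "integrable lborel (T k)" for k
    unfolding T_def by (rule integrable_mult_indicator[of "{x. norm x \<ge> n k}" lborel, OF _ i1, simplified mult.commute[of "indicator _ _"] real_scaleR_def]) auto
  have iS: "integrable lborel (S k)" for k
    unfolding S_def using iT[of k]
    by (intro Bochner_Integration.integrable_add integrable_mult_right integrable_real_indicator) (auto simp: emeasure_lborel_cball_finite[unfolded infinity_ennreal_def])
  have iE: "integrable lborel (E k)" for k
    by (rule integrable_dominated[OF iS[of k] cE]) (use E0 ES in auto)
  have limT: "(\<lambda>k. \<integral>x. T k x \<partial>lborel) \<longlonglongrightarrow> 0"
  proof -
    have "(\<lambda>k. \<integral>x. T k x \<partial>lborel) \<longlonglongrightarrow> (\<integral>x. 0 \<partial>(lborel :: (real^'n) measure))"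
    proof (rule integral_dominated_convergence[OF _ _ i1])
      show "AE x in lborel. (\<lambda>k. T k x) \<longlonglongrightarrow> 0"
      proof (rule AE_I2, rule tendsto_eventually)
        fix x :: "real^'n"
        obtain N :: nat where N: "real N \<ge> norm x" using real_arch_simple by blast
        show "\<forall>\<^sub>F k in sequentially. T k x = 0"
          using eventually_ge_at_top[of N] by eventually_elim (use N in \<open>auto simp: T_def n_def indicator_def\<close>)
      qed
      show "AE x in lborel. norm (T k x) \<le> (g x)\<^sup>2 * u x" for k
        using nonneg by (auto simp: T_def indicator_def)
    qed (use iT in auto)
    then show ?thesis by simp
  qed
  have limS: "(\<lambda>k. \<integral>x. S k x \<partial>lborel) \<longlonglongrightarrow> 0"
  proof -
    define d where "d = CARD('n)"
    have eq: "(\<integral>x. S k x \<partial>lborel) = 256 * M\<^sup>2 * B * ((n k)\<^sup>2 * (unit_ball_vol d * (2 / n k) ^ d)) + 512 * K * (\<integral>x. T k x \<partial>lborel)" for k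
    proof -
      have "(\<integral>x. S k x \<partial>lborel) = 256 * M\<^sup>2 * B * (n k)\<^sup>2 * measure lborel (cball (0::real^'n) (2 / n k)) + 512 * K * (\<integral>x. T k x \<partial>lborel)"
        unfolding S_def using iT[of k]
        by (subst Bochner_Integration.integral_add) (auto simp: emeasure_lborel_cball_finite[unfolded infinity_ennreal_def] intro!: integrable_mult_right integrable_real_indicator)
      also have "measure lborel (cball (0::real^'n) (2 / n k)) = unit_ball_vol d * (2 / n k) ^ d"
        using content_cball[of "2 / n k" "0::real^'n"] n[of k] by (simp add: d_def)
      finally show ?thesis by (simp add: mult.assoc)
    qed
    have "(\<lambda>k. (n k)\<^sup>2 * (unit_ball_vol d * (2 / n k) ^ d)) \<longlonglongrightarrow> 0"
    proof (rule Lim_null_comparison)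
      show "(\<lambda>k. unit_ball_vol d * 2 ^ d * (1 / n k)) \<longlonglongrightarrow> 0"
        unfolding n_def
        using tendsto_mult[OF tendsto_const[of "unit_ball_vol d * 2 ^ d"] LIMSEQ_Suc[OF lim_1_over_n[where 'a=real]]] by simp
      show "\<forall>\<^sub>F k in sequentially. norm ((n k)\<^sup>2 * (unit_ball_vol d * (2 / n k) ^ d)) \<le> unit_ball_vol d * 2 ^ d * (1 / n k)"
      proof (rule always_eventually, rule allI)
        fix k
        \<comment> \<open>The squared gradient \<open>n^2\<close> competes with a volume of order
          \<open>n^(-d)\<close>; since \<open>d \<ge> 3\<close> the product is at most of order
          \<open>1 / n\<close>.\<close>
        have "n k ^ 3 \<le> n k ^ d" using dim n[of k] by (intro power_increasing) (auto simp: d_def)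
        then have "(n k)\<^sup>2 / n k ^ d \<le> (n k)\<^sup>2 / n k ^ 3" using n[of k] by (intro divide_left_mono) auto
        also have "\<dots> = 1 / n k" using n[of k] by (simp add: power2_eq_square power3_eq_cube)
        finally have "unit_ball_vol d * 2 ^ d * ((n k)\<^sup>2 / n k ^ d) \<le> unit_ball_vol d * 2 ^ d * (1 / n k)"
          by (intro mult_left_mono) auto
        then show "norm ((n k)\<^sup>2 * (unit_ball_vol d * (2 / n k) ^ d)) \<le> unit_ball_vol d * 2 ^ d * (1 / n k)"
          using n[of k] by (simp add: power_divide abs_mult mult_ac)
      qed
    qed
    then have "(\<lambda>k. \<integral>x. S k x \<partial>lborel) \<longlonglongrightarrow> 256 * M\<^sup>2 * B * 0 + 512 * K * 0"
      unfolding eq by (intro tendsto_intros limT)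
    then show ?thesis by simp
  qed
  have limE: "(\<lambda>k. \<integral>x. E k x \<partial>lborel) \<longlonglongrightarrow> 0"
  proof (rule Lim_null_comparison[OF always_eventually limS], rule allI)
    fix k
    have "0 \<le> (\<integral>x. E k x \<partial>lborel)" by (intro Bochner_Integration.integral_nonneg E0)
    moreover have "(\<integral>x. E k x \<partial>lborel) \<le> (\<integral>x. S k x \<partial>lborel)"
      by (intro integral_mono iE iS ES)
    ultimately show "norm (\<integral>x. E k x \<partial>lborel) \<le> (\<integral>x. S k x \<partial>lborel)" by simp
  qed
  let ?N = "\<integral>x. (norm (g' x))\<^sup>2 * v x \<partial>lborel"
  \<comment> \<open>For fixed \<open>\<delta>\<close> the error vanishes as \<open>k\<close> grows.
    Only afterwards does \<open>\<delta>\<close> tend to 0, since the factor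
    \<open>1 + 1 / \<delta>\<close> of the error blows up.\<close>
  have bound: "\<Lambda> * (\<integral>x. (g x)\<^sup>2 * u x \<partial>lborel) \<le> (1 + \<delta>) * ?N" if \<delta>: "\<delta> > 0" for \<delta>
  proof -
    have le: "\<Lambda> * ((\<integral>x. (g x * C k x)\<^sup>2 * u x \<partial>lborel) - \<kappa> * (\<integral>x. (g x * C k x) * u x \<partial>lborel)\<^sup>2)
      \<le> (1 + \<delta>) * ?N + (1 + 1 / \<delta>) * (\<integral>x. E k x \<partial>lborel)" for k
    proof -
      let ?G = "\<lambda>x. g x *\<^sub>R C' k x + C k x *\<^sub>R g' x"
      have cG: "continuous_on UNIV ?G" by (intro continuous_intros cg g C cC)
      have "\<Lambda> * ((\<integral>x. (g x * C k x)\<^sup>2 * u x \<partial>lborel) - \<kappa> * (\<integral>x. (g x * C k x) * u x \<partial>lborel)\<^sup>2)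
        \<le> (\<integral>x. (norm (?G x))\<^sup>2 * v x \<partial>lborel)"
      proof (rule quadratic_inequality_C1_compact[OF cont nonneg test])
        show "GDERIV (\<lambda>x. g x * C k x) x :> ?G x" for x
          by (rule GDERIV_mult[OF g(1) C(1)])
        show "g x * C k x = 0" if "norm x < 1 / n k \<or> norm x > 2 * n k" for x
          using annulus_cutoff_support[OF n(1) that] by (simp add: C_def)
      qed (use cG n in auto)
      also have "\<dots> \<le> (\<integral>x. (1 + \<delta>) * ((norm (g' x))\<^sup>2 * v x) + (1 + 1 / \<delta>) * E k x \<partial>lborel)"
      proof -
        have le: "(norm (?G x))\<^sup>2 * v x \<le> (1 + \<delta>) * ((norm (g' x))\<^sup>2 * v x) + (1 + 1 / \<delta>) * E k x" for x
        proof -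
          have "(norm (?G x))\<^sup>2 \<le> (1 + \<delta>) * (norm (C k x *\<^sub>R g' x))\<^sup>2 + (1 + 1 / \<delta>) * (norm (g x *\<^sub>R C' k x))\<^sup>2"
            using norm_add_squared_le[OF \<delta>, of "C k x *\<^sub>R g' x" "g x *\<^sub>R C' k x"] by (simp add: add.commute)
          also have "\<dots> \<le> (1 + \<delta>) * (norm (g' x))\<^sup>2 + (1 + 1 / \<delta>) * ((g x)\<^sup>2 * (norm (C' k x))\<^sup>2)"
            using \<delta> Cabs(2)[of k x]
            by (intro add_mono mult_left_mono) (auto simp: power_mult_distrib mult_left_le_one_le)
          finally have "(norm (?G x))\<^sup>2 * v x \<le> ((1 + \<delta>) * (norm (g' x))\<^sup>2 + (1 + 1 / \<delta>) * ((g x)\<^sup>2 * (norm (C' k x))\<^sup>2)) * v x"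
            by (intro mult_right_mono nonneg)
          then show ?thesis by (simp add: E_def algebra_simps)
        qed
        have i: "integrable lborel (\<lambda>x. (1 + \<delta>) * ((norm (g' x))\<^sup>2 * v x) + (1 + 1 / \<delta>) * E k x)"
          using i2 iE by auto
        show ?thesis
          by (intro integral_mono i le integrable_dominated[OF i])
             (auto intro!: continuous_intros cG cont le simp: abs_mult nonneg)
      qed
      also have "\<dots> = (1 + \<delta>) * ?N + (1 + 1 / \<delta>) * (\<integral>x. E k x \<partial>lborel)"
        using i2 iE by simp
      finally show ?thesis .
    qed
    have l1: "(\<lambda>k. \<Lambda> * ((\<integral>x. (g x * C k x)\<^sup>2 * u x \<partial>lborel) - \<kappa> * (\<integral>x. (g x * C k x) * u x \<partial>lborel)\<^sup>2))
       \<longlonglongrightarrow> \<Lambda> * ((\<integral>x. (g x)\<^sup>2 * u x \<partial>lborel) - 0)"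
      by (intro tendsto_intros L1 L2)
    have l2: "(\<lambda>k. (1 + \<delta>) * ?N + (1 + 1 / \<delta>) * (\<integral>x. E k x \<partial>lborel)) \<longlonglongrightarrow> (1 + \<delta>) * ?N + (1 + 1 / \<delta>) * 0"
      by (intro tendsto_intros limE)
    have "\<Lambda> * ((\<integral>x. (g x)\<^sup>2 * u x \<partial>lborel) - 0) \<le> (1 + \<delta>) * ?N + (1 + 1 / \<delta>) * 0"
      by (rule LIMSEQ_le[OF l1 l2]) (use le in blast)
    then show ?thesis by simp
  qed
  have "((\<lambda>\<delta>. (1 + \<delta>) * ?N) \<longlongrightarrow> (1 + 0) * ?N) (at_right 0)" by (intro tendsto_intros)
  then have "\<Lambda> * (\<integral>x. (g x)\<^sup>2 * u x \<partial>lborel) \<le> (1 + 0) * ?N"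
    by (rule tendsto_lowerbound) (auto intro: eventually_mono[OF eventually_at_right_less] bound)
  then show ?thesis by simp
qed

section \<open>Integration by parts against the Barenblatt weight\<close>

text \<open>Cut off at a radius of order \<open>k\<close> to reach bounded support. The term with
  the derivative on the cutoff is at most \<open>16 |f|\<close>, uniformly in \<open>k\<close>, and
  vanishes pointwise, so dominated convergence removes it.\<close>

lemma integral_gradient_radial_integrable:
  fixes f :: "'a::euclidean_space \<Rightarrow> real"
  assumes f: "\<And>x. GDERIV f x :> f' x" and cont: "continuous_on UNIV f'"
    and i1: "integrable lborel f" and i2: "integrable lborel (\<lambda>x. f' x \<bullet> x)"
  shows "(\<integral>x. f' x \<bullet> x \<partial>lborel) = - real DIM('a) * (\<integral>x. f x \<partial>lborel)"
proof -
  note cf = GDERIV_imp_continuous_on[OF f]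
  define s where "s k = inverse ((real (Suc k))\<^sup>2)" for k
  have s: "s k > 0" for k by (simp add: s_def)
  define X where "X k x = 1 - step (s k * (x \<bullet> x))" for k and x :: 'a
  define X' where "X' k x = - ((2 * s k * step' (s k * (x \<bullet> x))) *\<^sub>R x)" for k and x :: 'a
  have X: "GDERIV (X k) x :> X' k x" for k x
    unfolding X_def[abs_def] X'_def
    using GDERIV_diff[OF GDERIV_const[of 1 x] GDERIV_radial_step[of "s k" x]] by simp
  have cX: "continuous_on UNIV (X k)" for k by (rule GDERIV_imp_continuous_on[OF X])
  have cX': "continuous_on UNIV (X' k)" for k
    unfolding X'_def[abs_def]
    by (intro continuous_intros continuous_on_compose2[OF continuous_step']) auto
  have Xb: "\<bar>X k x\<bar> \<le> 1" for k x using step_bounds[of "s k * (x \<bullet> x)"] by (simp add: X_def)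
  have X'b: "\<bar>X' k x \<bullet> x\<bar> \<le> 16" for k x
    using radial_step_gradient_bounds(1)[OF s, of k x] by (simp add: X'_def abs_mult)
  have near: "\<forall>\<^sub>F k in sequentially. s k * (x \<bullet> x) \<le> 1" for x :: 'a
  proof -
    obtain N :: nat where N: "real N \<ge> norm x" using real_arch_simple by blast
    show ?thesis
      using eventually_ge_at_top[of N]
    proof eventually_elim
      case (elim k)
      have "(norm x)\<^sup>2 \<le> (real (Suc k))\<^sup>2" using N elim by (intro power_mono) auto
      then show ?case unfolding s_def power2_norm_eq_inner by (simp add: field_simps del: of_nat_Suc)
    qed
  qed
  have limX: "(\<lambda>k. X k x) \<longlonglongrightarrow> 1" and limX': "(\<lambda>k. X' k x \<bullet> x) \<longlonglongrightarrow> 0" for x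
  proof -
    show "(\<lambda>k. X k x) \<longlonglongrightarrow> 1"
      by (rule tendsto_eventually[OF eventually_mono[OF near[of x]]]) (simp add: X_def step_eq_0)
    show "(\<lambda>k. X' k x \<bullet> x) \<longlonglongrightarrow> 0"
      by (rule tendsto_eventually[OF eventually_mono[OF near[of x]]]) (simp add: X'_def step'_eq_0)
  qed
  have id: "(\<integral>x. (f x * (X' k x \<bullet> x) + X k x * (f' x \<bullet> x)) \<partial>lborel) = - real DIM('a) * (\<integral>x. f x * X k x \<partial>lborel)" for k
  proof -
    have "(\<integral>x. (f x *\<^sub>R X' k x + X k x *\<^sub>R f' x) \<bullet> x \<partial>lborel) = - real DIM('a) * (\<integral>x. f x * X k x \<partial>lborel)"
    proof (rule integral_gradient_radial)
      show "GDERIV (\<lambda>x. f x * X k x) x :> f x *\<^sub>R X' k x + X k x *\<^sub>R f' x" for x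
        by (rule GDERIV_mult[OF f X])
      show "continuous_on UNIV (\<lambda>x. f x *\<^sub>R X' k x + X k x *\<^sub>R f' x)"
        by (intro continuous_intros cf cX cX' cont)
      show "f x * X k x = 0" if "norm x > 2 * real (Suc k)" for x
      proof -
        have "(2 * real (Suc k))\<^sup>2 \<le> (norm x)\<^sup>2" using that by (intro power_mono) auto
        then have "4 * (real (Suc k))\<^sup>2 \<le> x \<bullet> x" unfolding power2_norm_eq_inner by (simp add: power_mult_distrib del: of_nat_Suc)
        then have "s k * (x \<bullet> x) \<ge> 4" by (simp add: s_def field_simps del: of_nat_Suc)
        then show ?thesis by (simp add: X_def step_eq_1)
      qed
    qed
    then show ?thesis by (simp add: inner_add_left)
  qed
  have L1: "(\<lambda>k. \<integral>x. (f x * (X' k x \<bullet> x) + X k x * (f' x \<bullet> x)) \<partial>lborel) \<longlonglongrightarrow> (\<integral>x. f' x \<bullet> x \<partial>lborel)"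
  proof (rule integral_dominated_convergence[where w="\<lambda>x. 16 * \<bar>f x\<bar> + \<bar>f' x \<bullet> x\<bar>"])
    show "AE x in lborel. (\<lambda>k. f x * (X' k x \<bullet> x) + X k x * (f' x \<bullet> x)) \<longlonglongrightarrow> f' x \<bullet> x"
    proof (rule AE_I2)
      fix x
      have "(\<lambda>k. f x * (X' k x \<bullet> x) + X k x * (f' x \<bullet> x)) \<longlonglongrightarrow> f x * 0 + 1 * (f' x \<bullet> x)"
        by (intro tendsto_intros limX limX')
      then show "(\<lambda>k. f x * (X' k x \<bullet> x) + X k x * (f' x \<bullet> x)) \<longlonglongrightarrow> f' x \<bullet> x" by simp
    qed
    show "AE x in lborel. norm (f x * (X' k x \<bullet> x) + X k x * (f' x \<bullet> x)) \<le> 16 * \<bar>f x\<bar> + \<bar>f' x \<bullet> x\<bar>" for k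
    proof (rule AE_I2)
      fix x
      have "\<bar>f x * (X' k x \<bullet> x)\<bar> \<le> 16 * \<bar>f x\<bar>" "\<bar>X k x * (f' x \<bullet> x)\<bar> \<le> \<bar>f' x \<bullet> x\<bar>"
        using mult_left_mono[OF X'b[of k x], of "\<bar>f x\<bar>"] mult_right_mono[OF Xb[of k x], of "\<bar>f' x \<bullet> x\<bar>"]
        by (auto simp: abs_mult mult.commute)
      then show "norm (f x * (X' k x \<bullet> x) + X k x * (f' x \<bullet> x)) \<le> 16 * \<bar>f x\<bar> + \<bar>f' x \<bullet> x\<bar>" by simp
    qed
  qed (use i1 i2 in \<open>auto intro!: borel_measurable_continuous_onI continuous_intros cf cX cX' cont\<close>)
  have L2: "(\<lambda>k. \<integral>x. f x * X k x \<partial>lborel) \<longlonglongrightarrow> (\<integral>x. f x \<partial>lborel)"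
  proof (rule integral_dominated_convergence[where w="\<lambda>x. \<bar>f x\<bar>"])
    show "AE x in lborel. (\<lambda>k. f x * X k x) \<longlonglongrightarrow> f x"
    proof (rule AE_I2)
      fix x
      have "(\<lambda>k. f x * X k x) \<longlonglongrightarrow> f x * 1" by (intro tendsto_intros limX)
      then show "(\<lambda>k. f x * X k x) \<longlonglongrightarrow> f x" by simp
    qed
    show "AE x in lborel. norm (f x * X k x) \<le> \<bar>f x\<bar>" for k
      using mult_left_mono[OF Xb[of k], of "\<bar>f _\<bar>"] by (auto simp: abs_mult)
  qed (use i1 in \<open>auto intro!: borel_measurable_continuous_onI continuous_intros cf cX\<close>)
  have "(\<lambda>k. - real DIM('a) * (\<integral>x. f x * X k x \<partial>lborel)) \<longlonglongrightarrow> - real DIM('a) * (\<integral>x. f x \<partial>lborel)"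
    by (intro tendsto_intros L2)
  with L1 show ?thesis unfolding id by (rule LIMSEQ_unique)
qed

definition rho :: "real \<Rightarrow> real \<Rightarrow> real^'n \<Rightarrow> real" where
  "rho m D x = D + (1 - m) / (2 * m) * (norm x)\<^sup>2"

lemma V_eq_rho: "V m D x = rho m D x powr (- 1 / (1 - m))"
  by (simp add: V_def rho_def)

lemma GDERIV_rho: "m > 0 \<Longrightarrow> GDERIV (rho m D) x :> ((1 - m) / m) *\<^sub>R x"
  unfolding rho_def[abs_def] power2_norm_eq_inner gderiv_def
  by (auto intro!: derivative_eq_intros simp: inner_commute field_simps)

lemma continuous_rho: "continuous_on S (rho m D)"
  unfolding rho_def[abs_def] by (intro continuous_intros)

context
  fixes m D :: real
  assumes m: "0 < m" "m < 1" and D: "D > 0"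
begin

lemma rho_ge: "rho m D x \<ge> D" "rho m D x \<ge> (1 - m) / (2 * m) * (norm x)\<^sup>2"
  using m D by (auto simp: rho_def)

lemma rho_pos: "rho m D x > 0"
  using rho_ge(1)[of x] D by simp

lemma V_pos: "V m D x > 0"
  using rho_pos[of x] by (simp add: V_eq_rho)

lemma V_powr_minus: "V m D x powr (m - 1) = rho m D x"
proof -
  have "- 1 / (1 - m) * (m - 1) = 1" using m by (simp add: field_simps)
  then show ?thesis using rho_pos[of x] by (simp add: V_eq_rho powr_powr)
qed

lemma V_powr_m: "V m D x powr m = rho m D x * V m D x"
  using V_powr_minus[of x] V_pos[of x] powr_add[of "V m D x" "m - 1" 1] by simp

lemma V_powr_2_minus: "V m D x powr (2 - m) = V m D x / rho m D x"
  using V_powr_minus[of x] V_pos[of x] powr_diff[of "V m D x" 1 "m - 1"] by simp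

lemma continuous_V: "continuous_on S (V m D)"
  unfolding V_eq_rho[abs_def]
  by (intro continuous_intros continuous_rho) (simp add: rho_pos less_imp_neq[symmetric])

text \<open>The product is \<open>V^m\<close>, a power of \<open>rho\<close> with exponent
  \<open>- m / (1 - m)\<close>; the coefficient \<open>(1 - m) / (2 * m)\<close> in
  \<open>rho\<close> cancels this exponent in the chain rule.\<close>

lemma GDERIV_rho_V:
  fixes x :: "real^'n"
  shows "GDERIV (\<lambda>x. rho m D x * V m D x) x :> - (V m D x *\<^sub>R x)"
proof -
  let ?e = "- m / (1 - m)"
  have e: "1 + - 1 / (1 - m) = ?e" "?e - 1 = - 1 / (1 - m)" using m by (auto simp: field_simps)
  have "(\<lambda>x :: real^'n. rho m D x * V m D x) = (\<lambda>x. rho m D x powr ?e)"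
  proof
    fix x :: "real^'n"
    show "rho m D x * V m D x = rho m D x powr ?e"
      using rho_pos[of x] powr_add[of "rho m D x" 1 "- 1 / (1 - m)"] unfolding e(1) by (simp add: V_eq_rho)
  qed
  moreover have "((\<lambda>t. t powr ?e) has_real_derivative ?e * rho m D x powr (?e - 1)) (at (rho m D x))"
    using rho_pos[of x] by (rule has_real_derivative_powr)
  note GDERIV_DERIV_compose[OF GDERIV_rho[OF m(1)] this]
  ultimately show ?thesis
    using m unfolding e(2) by (simp add: V_eq_rho[of m D x])
qed

text \<open>\<open>H\<close> is the gradient of \<open>a * rho\<close>. Up to the factor
  \<open>(1 - m) / m\<close>, the cross term of its square is the radial derivative of
  \<open>a^2\<close> times \<open>rho V\<close>; the radial divergence identity for
  \<open>f = a^2 rho V\<close> trades it for terms without derivatives of \<open>a\<close>.\<close>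

lemma weighted_gradient_identity:
  fixes a :: "real^'n \<Rightarrow> real"
  assumes a: "\<And>x. GDERIV a x :> a' x" "continuous_on UNIV a'"
    and S: "integrable lborel (\<lambda>x. (a x)\<^sup>2 * (rho m D x * V m D x))"
    and Q: "integrable lborel (\<lambda>x. (a x)\<^sup>2 * (norm x)\<^sup>2 * V m D x)"
    and P: "integrable lborel (\<lambda>x. (norm (a' x))\<^sup>2 * (rho m D x)\<^sup>2 * V m D x)"
  defines "H \<equiv> \<lambda>x. rho m D x *\<^sub>R a' x + (a x * ((1 - m) / m)) *\<^sub>R x"
  shows "integrable lborel (\<lambda>x. (norm (H x))\<^sup>2 * V m D x)"
    and "(\<integral>x. (norm (H x))\<^sup>2 * V m D x \<partial>lborel)
     = (\<integral>x. (norm (a' x))\<^sup>2 * (rho m D x)\<^sup>2 * V m D x \<partial>lborel)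
      + (1 - m) / m\<^sup>2 * (\<integral>x. (a x)\<^sup>2 * (norm x)\<^sup>2 * V m D x \<partial>lborel)
      - real CARD('n) * ((1 - m) / m) * (\<integral>x. (a x)\<^sup>2 * (rho m D x * V m D x) \<partial>lborel)"
proof -
  let ?v = "V m D" and ?r = "rho m D" and ?c = "(1 - m) / m"
  note ca = GDERIV_imp_continuous_on[OF a(1)]
  define f where "f x = (a x)\<^sup>2 * (?r x * ?v x)" for x
  define T where "T x = 2 * a x * ?r x * ?v x * (a' x \<bullet> x)" for x
  define f' where "f' x = (a x)\<^sup>2 *\<^sub>R (- (?v x *\<^sub>R x)) + (?r x * ?v x) *\<^sub>R ((2 * a x) *\<^sub>R a' x)" for x
  have f: "GDERIV f x :> f' x" for x
  proof -
    have "GDERIV (\<lambda>x. (a x)\<^sup>2) x :> (2 * a x) *\<^sub>R a' x"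
      using GDERIV_mult[OF a(1) a(1), of x] by (simp add: power2_eq_square scaleR_add_left[symmetric])
    from GDERIV_mult[OF this GDERIV_rho_V] show ?thesis by (simp add: f_def[abs_def] f'_def)
  qed
  have f'x: "f' x \<bullet> x = T x - (a x)\<^sup>2 * (norm x)\<^sup>2 * ?v x" for x
    by (simp add: f'_def T_def inner_add_left inner_diff_left power2_norm_eq_inner mult_ac)
  have cf': "continuous_on UNIV f'"
    unfolding f'_def[abs_def] by (intro continuous_intros ca a continuous_rho continuous_V)
  have cT: "continuous_on UNIV T"
    unfolding T_def by (intro continuous_intros ca a continuous_rho continuous_V)
  \<comment> \<open>The factors are grouped so that \<open>2 x y \<le> x^2 + y^2\<close> yields
    exactly the integrands of \<open>P\<close> and \<open>Q\<close>.\<close>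
  have Tb: "\<bar>T x\<bar> \<le> (norm (a' x))\<^sup>2 * (?r x)\<^sup>2 * ?v x + (a x)\<^sup>2 * (norm x)\<^sup>2 * ?v x" for x
  proof -
    have "\<bar>T x\<bar> = 2 * \<bar>a x\<bar> * ?r x * \<bar>a' x \<bullet> x\<bar> * ?v x"
      using rho_pos[of x] V_pos[of x] by (simp add: T_def abs_mult)
    also have "\<dots> \<le> 2 * \<bar>a x\<bar> * ?r x * (norm (a' x) * norm x) * ?v x"
      using rho_pos[of x] V_pos[of x] Cauchy_Schwarz_ineq2[of "a' x" x]
      by (intro mult_right_mono mult_left_mono) auto
    also have "\<dots> = 2 * (norm (a' x) * ?r x) * (\<bar>a x\<bar> * norm x) * ?v x" by (simp add: mult_ac)
    also have "\<dots> \<le> ((norm (a' x) * ?r x)\<^sup>2 + (\<bar>a x\<bar> * norm x)\<^sup>2) * ?v x"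
      using V_pos[of x] by (intro mult_right_mono sum_squares_bound) auto
    finally show ?thesis by (simp add: power_mult_distrib algebra_simps)
  qed
  have iT: "integrable lborel T"
    by (rule integrable_dominated[OF Bochner_Integration.integrable_add[OF P Q] cT Tb])
  have if': "integrable lborel (\<lambda>x. f' x \<bullet> x)"
    unfolding f'x using iT Q by (rule Bochner_Integration.integrable_diff)
  have if0: "integrable lborel f" unfolding f_def by (rule S)
  have "(\<integral>x. f' x \<bullet> x \<partial>lborel) = - real CARD('n) * (\<integral>x. f x \<partial>lborel)"
    using integral_gradient_radial_integrable[OF f cf' if0 if'] by simp
  then have IT: "(\<integral>x. T x \<partial>lborel) = (\<integral>x. (a x)\<^sup>2 * (norm x)\<^sup>2 * ?v x \<partial>lborel) - real CARD('n) * (\<integral>x. f x \<partial>lborel)"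
    unfolding f'x using iT Q by (simp add: Bochner_Integration.integral_diff)
  have H: "(norm (H x))\<^sup>2 * ?v x = (norm (a' x))\<^sup>2 * (?r x)\<^sup>2 * ?v x + ?c * T x + ?c\<^sup>2 * ((a x)\<^sup>2 * (norm x)\<^sup>2 * ?v x)" for x
  proof -
    have "(norm (r *\<^sub>R p + (y * c) *\<^sub>R x))\<^sup>2 * z
        = (norm p)\<^sup>2 * r\<^sup>2 * z + c * (2 * y * r * z * (p \<bullet> x)) + c\<^sup>2 * (y\<^sup>2 * (norm x)\<^sup>2 * z)"
      for r y c z and p :: "real^'n"
      unfolding power2_norm_eq_inner
      by (simp add: inner_add_left inner_add_right inner_commute power2_eq_square algebra_simps)
    then show ?thesis unfolding H_def T_def .
  qed
  show "integrable lborel (\<lambda>x. (norm (H x))\<^sup>2 * ?v x)"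
    unfolding H using P iT Q by (intro Bochner_Integration.integrable_add integrable_mult_right)
  have "(\<integral>x. (norm (H x))\<^sup>2 * ?v x \<partial>lborel) = (\<integral>x. (norm (a' x))\<^sup>2 * (?r x)\<^sup>2 * ?v x \<partial>lborel)
      + ?c * (\<integral>x. T x \<partial>lborel) + ?c\<^sup>2 * (\<integral>x. (a x)\<^sup>2 * (norm x)\<^sup>2 * ?v x \<partial>lborel)"
    unfolding H using P iT Q
    by (subst Bochner_Integration.integral_add Bochner_Integration.integral_add integral_mult_right_zero |
        intro Bochner_Integration.integrable_add integrable_mult_right)+ auto
  also have "\<dots> = (\<integral>x. (norm (a' x))\<^sup>2 * (?r x)\<^sup>2 * ?v x \<partial>lborel)
      + (?c + ?c\<^sup>2) * (\<integral>x. (a x)\<^sup>2 * (norm x)\<^sup>2 * ?v x \<partial>lborel) - real CARD('n) * ?c * (\<integral>x. f x \<partial>lborel)"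
    unfolding IT by (simp add: algebra_simps)
  \<comment> \<open>One \<open>?c\<close> stems from the integrated cross term, \<open>?c^2\<close>
    from the square of the second summand of \<open>H\<close>.\<close>
  also have "?c + ?c\<^sup>2 = (1 - m) / m\<^sup>2" using m by (simp add: field_simps power2_eq_square)
  finally show "(\<integral>x. (norm (H x))\<^sup>2 * V m D x \<partial>lborel)
     = (\<integral>x. (norm (a' x))\<^sup>2 * (rho m D x)\<^sup>2 * V m D x \<partial>lborel)
      + (1 - m) / m\<^sup>2 * (\<integral>x. (a x)\<^sup>2 * (norm x)\<^sup>2 * V m D x \<partial>lborel)
      - real CARD('n) * ((1 - m) / m) * (\<integral>x. (a x)\<^sup>2 * (rho m D x * V m D x) \<partial>lborel)"
    by (simp add: f_def)
qed

end

section \<open>The spectral constant\<close>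

lemma test_fn_continuous: "test_fn h \<Longrightarrow> continuous_on UNIV h"
  unfolding test_fn_def
  by (auto elim!: smooth_fn.cases intro!: continuous_at_imp_continuous_on differentiable_imp_continuous_within)

lemma test_fn_bounded_support:
  assumes "test_fn h"
  obtains R where "\<And>x. norm x > R \<Longrightarrow> h x = 0"
proof -
  have "bounded {x. h x \<noteq> 0}"
    using assms unfolding test_fn_def by (meson bounded_subset closure_subset compact_imp_bounded)
  then obtain R where "\<And>x. h x \<noteq> 0 \<Longrightarrow> norm x \<le> R" unfolding bounded_iff by auto
  then show thesis by (intro that[of R]) force
qed

text \<open>Witness that the infimum behind \<open>lambda_md\<close> runs over a nonempty set: a
  bump of radius 1/2 about a unit vector. Taking two different values, it cannot agree everywhere
  with its own mean.\<close>

lemma test_fn_exists: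
  obtains h :: "real^'n \<Rightarrow> real" and c where "test_fn h" "h 0 = 0" "h c \<noteq> 0"
proof -
  define c :: "real^'n" where "c = axis undefined 1"
  have nc: "norm c = 1" by (simp add: c_def)
  define h where "h x = flat 0 (1 / 4 - (x - c) \<bullet> (x - c))" for x
  have sub: "{x. h x \<noteq> 0} \<subseteq> cball c (1 / 2)"
  proof
    fix x assume "x \<in> {x. h x \<noteq> 0}"
    then have "(norm (x - c))\<^sup>2 \<le> (1 / 2)\<^sup>2"
      by (auto simp: h_def flat_def power2_norm_eq_inner power_divide split: if_splits)
    then show "x \<in> cball c (1 / 2)"
      using abs_le_square_iff[of "norm (x - c)" "1 / 2"] by (simp add: dist_norm norm_minus_commute)
  qed
  then have cl: "closure {x. h x \<noteq> 0} \<subseteq> cball c (1 / 2)" by (rule closure_minimal) simp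
  have "compact (closure {x. h x \<noteq> 0})"
    using bounded_subset[OF bounded_cball sub] by (simp add: compact_closure)
  moreover have "0 \<notin> closure {x. h x \<noteq> 0}" using cl nc by auto
  moreover have "smooth_fn h" unfolding h_def by (rule bump_algebra_smooth[OF bump_algebra.flat])
  ultimately have "test_fn h" by (simp add: test_fn_def)
  moreover have "c \<bullet> c = 1" using nc by (simp add: norm_eq_1)
  then have "h 0 = 0" "h c \<noteq> 0" by (simp_all add: h_def flat_def)
  ultimately show thesis by (rule that)
qed

context
  fixes m D :: real
  assumes m: "0 < m" "m < 1" and D: "D > 0"
begin

lemma continuous_V_over_rho: "continuous_on S (\<lambda>x. V m D x / rho m D x)"
  by (intro continuous_intros continuous_V[OF m D] continuous_rho) (simp add: rho_pos[OF m D] less_imp_neq[symmetric])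

lemma V_over_rho_pos: "V m D x / rho m D x > 0"
  by (simp add: V_pos[OF m D] rho_pos[OF m D])

lemma test_fn_integrable:
  assumes "test_fn h"
  shows "integrable lborel (\<lambda>x. h x * (V m D x / rho m D x))"
    and "integrable lborel (\<lambda>x. (h x)\<^sup>2 * (V m D x / rho m D x))"
proof -
  obtain R where R: "\<And>x. norm x > R \<Longrightarrow> h x = 0" using test_fn_bounded_support[OF assms] by blast
  show "integrable lborel (\<lambda>x. h x * (V m D x / rho m D x))"
    by (rule integrable_bounded_support[of _ R])
       (auto intro!: continuous_on_mult continuous_V_over_rho test_fn_continuous[OF assms] simp: R simp del: times_divide_eq_right)
  show "integrable lborel (\<lambda>x. (h x)\<^sup>2 * (V m D x / rho m D x))"
    by (rule integrable_bounded_support[of _ R])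
       (auto intro!: continuous_on_mult continuous_on_power continuous_V_over_rho test_fn_continuous[OF assms] simp: R simp del: times_divide_eq_right)
qed

text \<open>If the weight is not integrable, its Bochner integral is \<open>0\<close>, so \<open>hbar_md\<close> vanishes as well
  and \<open>m < m_star\<close> need not be related to integrability.\<close>

lemma hbar_md_cases:
  fixes h :: "real^'n \<Rightarrow> real"
  defines "u \<equiv> \<lambda>x :: real^'n. V m D x / rho m D x"
  obtains "hbar_md m D h = 0" "(if m < m_star CARD('n) then 0 else 1 / (\<integral>x. u x \<partial>lborel)) = 0"
  | "integrable lborel u" "(\<integral>x. u x \<partial>lborel) > 0" "hbar_md m D h = (\<integral>x. h x * u x \<partial>lborel) / (\<integral>x. u x \<partial>lborel)"
    "\<not> m < m_star CARD('n)"
proof (cases "m < m_star CARD('n) \<or> \<not> integrable lborel u")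
  case True
  then have "hbar_md m D h = 0 \<and> (if m < m_star CARD('n) then 0 else 1 / (\<integral>x. u x \<partial>lborel)) = 0"
    by (auto simp: hbar_md_def V_powr_2_minus[OF m D] u_def not_integrable_integral_eq)
  then show thesis using that(1) by blast
next
  case False
  then have "(\<integral>x. u x \<partial>lborel) > 0"
    unfolding u_def
    by (intro integral_pos_continuous[OF continuous_V_over_rho] less_imp_le V_over_rho_pos) auto
  with False show thesis
    by (intro that(2)) (auto simp: hbar_md_def V_powr_2_minus[OF m D] u_def)
qed

text \<open>Expand the square about the mean. Where \<open>hbar_md\<close> is 0 by convention the
  coefficient of the squared first moment is 0 too, so one formula covers both regimes of
  \<open>m\<close>.\<close>

lemma hbar_md_variance:
  fixes h :: "real^'n \<Rightarrow> real"
  assumes h: "test_fn h"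
  defines "u \<equiv> \<lambda>x :: real^'n. V m D x / rho m D x"
  shows "integrable lborel (\<lambda>x. (h x - hbar_md m D h)\<^sup>2 * u x)"
    and "(\<integral>x. (h x - hbar_md m D h)\<^sup>2 * u x \<partial>lborel) = (\<integral>x. (h x)\<^sup>2 * u x \<partial>lborel)
       - (if m < m_star CARD('n) then 0 else 1 / (\<integral>x. u x \<partial>lborel)) * (\<integral>x. h x * u x \<partial>lborel)\<^sup>2"
proof -
  let ?b = "hbar_md m D h"
  let ?\<kappa> = "if m < m_star CARD('n) then 0 else 1 / (\<integral>x. u x \<partial>lborel)"
  have i: "integrable lborel (\<lambda>x. h x * u x)" "integrable lborel (\<lambda>x. (h x)\<^sup>2 * u x)"
    using test_fn_integrable[OF h] unfolding u_def .
  consider "?b = 0" "?\<kappa> = 0" | "integrable lborel u" "(\<integral>x. u x \<partial>lborel) > 0"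
    "?b = (\<integral>x. h x * u x \<partial>lborel) / (\<integral>x. u x \<partial>lborel)" "\<not> m < m_star CARD('n)"
    using hbar_md_cases[of h] unfolding u_def by blast
  note cs = this
  have "integrable lborel (\<lambda>x. (h x - ?b)\<^sup>2 * u x)
     \<and> (\<integral>x. (h x - ?b)\<^sup>2 * u x \<partial>lborel) = (\<integral>x. (h x)\<^sup>2 * u x \<partial>lborel) - ?\<kappa> * (\<integral>x. h x * u x \<partial>lborel)\<^sup>2"
    using cs
  proof cases
    case 1
    show ?thesis unfolding 1 using i by simp
  next
    case 2
    let ?h = "\<lambda>x. ((h x)\<^sup>2 * u x - 2 * ?b * (h x * u x)) + ?b\<^sup>2 * u x"
    have e: "(\<lambda>x. (h x - ?b)\<^sup>2 * u x) = ?h"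
      by (auto simp: power2_eq_square algebra_simps)
    have "integrable lborel ?h"
      using i 2(1) by (intro Bochner_Integration.integrable_add Bochner_Integration.integrable_diff integrable_mult_right)
    moreover have "(\<integral>x. ?h x \<partial>lborel) = ((\<integral>x. (h x)\<^sup>2 * u x \<partial>lborel) - 2 * ?b * (\<integral>x. h x * u x \<partial>lborel)) + ?b\<^sup>2 * (\<integral>x. u x \<partial>lborel)"
      using i 2(1) by (subst Bochner_Integration.integral_add Bochner_Integration.integral_diff integral_mult_right_zero |
          intro Bochner_Integration.integrable_diff integrable_mult_right)+ auto
    moreover have "\<dots> = (\<integral>x. (h x)\<^sup>2 * u x \<partial>lborel) - ?\<kappa> * (\<integral>x. h x * u x \<partial>lborel)\<^sup>2"
    proof -
      have "?b\<^sup>2 * (\<integral>x. u x \<partial>lborel) = ?b * (\<integral>x. h x * u x \<partial>lborel)"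
        using 2(2) by (simp add: 2(3) power2_eq_square)
      moreover have "?\<kappa> * (\<integral>x. h x * u x \<partial>lborel)\<^sup>2 = ?b * (\<integral>x. h x * u x \<partial>lborel)"
        using 2(4) by (simp add: 2(3) power2_eq_square)
      ultimately show ?thesis by (simp only: mult.assoc)
    qed
    ultimately show ?thesis unfolding e by simp
  qed
  then show "integrable lborel (\<lambda>x. (h x - ?b)\<^sup>2 * u x)"
    "(\<integral>x. (h x - ?b)\<^sup>2 * u x \<partial>lborel) = (\<integral>x. (h x)\<^sup>2 * u x \<partial>lborel) - ?\<kappa> * (\<integral>x. h x * u x \<partial>lborel)\<^sup>2"
    by auto
qed

text \<open>Multiplying out the Rayleigh quotient turns the infimum into an inequality for every
  test function; where the denominator vanishes it is trivial.\<close>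

lemma lambda_md_nonneg: "lambda_md TYPE('n::finite) m D \<ge> 0"
  and lambda_md_test_fn:
    "test_fn (h :: real^'n \<Rightarrow> real) \<Longrightarrow>
      lambda_md TYPE('n) m D / m * ((\<integral>x. (h x)\<^sup>2 * (V m D x / rho m D x) \<partial>lborel)
       - (if m < m_star CARD('n) then 0 else 1 / (\<integral>x. V m D (x :: real^'n) / rho m D x \<partial>lborel))
         * (\<integral>x. h x * (V m D x / rho m D x) \<partial>lborel)\<^sup>2)
      \<le> (\<integral>x. (norm (grad h x))\<^sup>2 * V m D x \<partial>lborel)"
proof -
  define N where "N h = (\<integral>x. (norm (grad h x))\<^sup>2 * V m D x \<partial>lborel)" for h :: "real^'n \<Rightarrow> real"
  define Q where "Q h = (\<integral>x. (h x - hbar_md m D h)\<^sup>2 * (V m D x / rho m D x) \<partial>lborel)" for h :: "real^'n \<Rightarrow> real"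
  define A where "A = {N h / Q h | h. test_fn h \<and> Q h \<noteq> 0}"
  have lam: "lambda_md TYPE('n) m D = m * Inf A"
    unfolding lambda_md_def A_def N_def Q_def V_powr_2_minus[OF m D] ..
  have N0: "N h \<ge> 0" for h
    unfolding N_def by (intro Bochner_Integration.integral_nonneg mult_nonneg_nonneg less_imp_le[OF V_pos[OF m D]]) auto
  have Q0: "Q h \<ge> 0" for h
    unfolding Q_def by (intro Bochner_Integration.integral_nonneg mult_nonneg_nonneg less_imp_le[OF V_over_rho_pos]) auto
  have ge0: "a \<ge> 0" if "a \<in> A" for a using that N0 Q0 by (auto simp: A_def)
  \<comment> \<open>\<open>Inf\<close> of the empty set would be an arbitrary value; nonemptiness is
    what makes the lower bound 0 pass to the infimum.\<close>
  have "A \<noteq> {}"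
  proof -
    obtain h :: "real^'n \<Rightarrow> real" and c where h: "test_fn h" "h 0 = 0" "h c \<noteq> 0" by (rule test_fn_exists)
    obtain x0 where x0: "h x0 - hbar_md m D h \<noteq> 0" using h(2,3) by (metis right_minus_eq)
    have "Q h > 0"
      unfolding Q_def
    proof (rule integral_pos_continuous[OF _ hbar_md_variance(1)[OF h(1)]])
      show "continuous_on UNIV (\<lambda>x. (h x - hbar_md m D h)\<^sup>2 * (V m D x / rho m D x))"
        by (intro continuous_on_mult continuous_on_power continuous_on_diff continuous_on_const test_fn_continuous[OF h(1)] continuous_V_over_rho)
      show "0 \<le> (h x - hbar_md m D h)\<^sup>2 * (V m D x / rho m D x)" for x
        by (intro mult_nonneg_nonneg less_imp_le[OF V_over_rho_pos]) simp
      show "0 < (h x0 - hbar_md m D h)\<^sup>2 * (V m D x0 / rho m D x0)"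
        using x0 by (intro mult_pos_pos V_over_rho_pos) simp
    qed
    then show ?thesis using h(1) unfolding A_def by force
  qed
  then have "Inf A \<ge> 0" using ge0 by (rule cInf_greatest)
  then show "lambda_md TYPE('n) m D \<ge> 0" using m by (simp add: lam)
  have le: "Inf A * Q h \<le> N h" if "test_fn h" for h
  proof (cases "Q h = 0")
    case False
    have "Inf A \<le> N h / Q h"
      using that False ge0 by (intro cInf_lower bdd_belowI[of _ 0]) (auto simp: A_def)
    then show ?thesis using Q0[of h] False by (simp add: field_simps)
  qed (simp add: N0)
  show "lambda_md TYPE('n) m D / m * ((\<integral>x. (h x)\<^sup>2 * (V m D x / rho m D x) \<partial>lborel)
       - (if m < m_star CARD('n) then 0 else 1 / (\<integral>x. V m D (x :: real^'n) / rho m D x \<partial>lborel))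
         * (\<integral>x. h x * (V m D x / rho m D x) \<partial>lborel)\<^sup>2)
      \<le> (\<integral>x. (norm (grad h x))\<^sup>2 * V m D x \<partial>lborel)" if "test_fn h" for h :: "real^'n \<Rightarrow> real"
  proof -
    have "lambda_md TYPE('n) m D / m = Inf A" using m by (simp add: lam)
    then show ?thesis
      using le[OF that] unfolding N_def Q_def hbar_md_variance(2)[OF that] by (simp only:)
  qed
qed

end

section \<open>Pointwise estimates\<close>

text \<open>Bernoulli's inequality: \<open>t^p\<close> lies above its tangent at 1.\<close>

lemma one_minus_powr_le:
  fixes p t :: real
  assumes "p \<ge> 1" "0 < t" "t \<le> 1"
  shows "1 - t powr p \<le> p * (1 - t)"
proof (cases "t = 1")
  case False
  then have "t < 1" using assms by simp
  have "\<exists>z. t < z \<and> z < 1 \<and> 1 powr p - t powr p = (1 - t) * (p * z powr (p - 1))"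
    using assms by (intro MVT2[OF \<open>t < 1\<close>]) (auto intro!: has_real_derivative_powr)
  then obtain z where z: "t < z" "z < 1" "1 - t powr p = (1 - t) * (p * z powr (p - 1))" by auto
  have "z powr (p - 1) \<le> 1" using z assms by (intro powr_le1) auto
  then have "(1 - t) * (p * z powr (p - 1)) \<le> (1 - t) * (p * 1)" using assms \<open>t < 1\<close> by (intro mult_left_mono) auto
  then show ?thesis using z by (simp add: mult.commute)
qed simp

text \<open>Profiles with parameters \<open>D\<close> and \<open>D'\<close> have ratio
  \<open>((D' + q) / (D + q))^p\<close> with \<open>q\<close> quadratic in \<open>|x|\<close>. This
  ratio differs from 1 by a term of order \<open>1 / (Ds + q)\<close>, and multiplication by
  \<open>rho\<close> compensates precisely that decay.\<close>

lemma sandwich_bound: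
  fixes w :: "real^'n \<Rightarrow> real"
  assumes m: "0 < m" "m < 1" and D: "0 < D1" "D1 \<le> Ds" "Ds \<le> D0"
    and sandwich: "\<forall>x. V m D0 x \<le> w x * V m Ds x \<and> w x * V m Ds x \<le> V m D1 x"
  obtains M where "\<And>x. \<bar>(w x - 1) * rho m Ds x\<bar> \<le> M"
proof -
  define p where "p = 1 / (1 - m)"
  have p: "p \<ge> 1" using m by (simp add: p_def)
  have V: "V m D x = rho m D x powr - p" for D and x :: "real^'n" by (simp add: V_eq_rho p_def)
  have Ds: "Ds > 0" and D0: "D0 > 0" using D by auto
  let ?U = "p * (Ds - D1) * (Ds / D1) powr p" and ?L = "p * (D0 - Ds)"
  have "\<bar>(w x - 1) * rho m Ds x\<bar> \<le> max ?U ?L" for x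
  proof -
    define q where "q = (1 - m) / (2 * m) * (norm x)\<^sup>2"
    have q: "q \<ge> 0" using m by (simp add: q_def)
    have r: "rho m D x = D + q" for D by (simp add: rho_def q_def)
    let ?R = "Ds + q"
    have ratio: "(D + q) powr - p / (?R powr - p) = (?R / (D + q)) powr p" if "D > 0" for D
      using that q Ds by (simp add: powr_divide powr_minus field_simps)
    have w1: "w x \<le> (?R / (D1 + q)) powr p"
    proof -
      have "w x \<le> V m D1 x / V m Ds x" using sandwich V_pos[OF m Ds, of x] by (simp add: pos_le_divide_eq)
      then show ?thesis using ratio[OF D(1)] by (simp add: V r)
    qed
    have w0: "w x \<ge> (?R / (D0 + q)) powr p"
    proof -
      have "w x \<ge> V m D0 x / V m Ds x" using sandwich V_pos[OF m Ds, of x] by (simp add: pos_divide_le_eq)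
      then show ?thesis using ratio[OF D0] by (simp add: V r)
    qed
    \<comment> \<open>The ratio is at least 1 here. Pulling out its power leaves one minus a power
      of a number at most 1, as Bernoulli's inequality requires; the extracted factor is largest at
      \<open>q = 0\<close>.\<close>
    have "(w x - 1) * ?R \<le> ?U"
    proof -
      have "((D1 + q) / ?R) powr p * (?R / (D1 + q)) powr p = 1"
        using D q by (simp add: powr_mult[symmetric])
      then have "(?R / (D1 + q)) powr p - 1 = (1 - ((D1 + q) / ?R) powr p) * (?R / (D1 + q)) powr p"
        by (simp add: algebra_simps)
      also have "\<dots> \<le> (p * (1 - (D1 + q) / ?R)) * (Ds / D1) powr p"
      proof (intro mult_mono one_minus_powr_le p powr_mono2)
        show "?R / (D1 + q) \<le> Ds / D1" using D q by (simp add: field_simps mult_right_mono)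
      qed (use D q p in \<open>auto simp: field_simps\<close>)
      also have "1 - (D1 + q) / ?R = (Ds - D1) / ?R" using Ds q by (simp add: field_simps)
      finally have "w x - 1 \<le> p * ((Ds - D1) / ?R) * (Ds / D1) powr p" using w1 by simp
      from mult_right_mono[OF this, of ?R] show ?thesis using Ds q by simp
    qed
    moreover have "(1 - w x) * ?R \<le> ?L"
    proof -
      have "1 - (?R / (D0 + q)) powr p \<le> p * (1 - ?R / (D0 + q))"
        using D q by (intro one_minus_powr_le p) auto
      also have "1 - ?R / (D0 + q) = (D0 - Ds) / (D0 + q)" using D0 q by (simp add: field_simps)
      also have "\<dots> \<le> (D0 - Ds) / ?R" using D q by (intro divide_left_mono) auto
      finally have "1 - w x \<le> p * ((D0 - Ds) / ?R)" using w0 p by (simp add: mult_left_mono)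
      from mult_right_mono[OF this, of ?R] show ?thesis using Ds q by simp
    qed
    ultimately show ?thesis unfolding r by (auto simp: abs_le_iff algebra_simps)
  qed
  then show thesis by (rule that)
qed

text \<open>Mean value theorem for \<open>s^(m-1) / (m - 1)\<close>, whose derivative is
  \<open>s^(m-2)\<close>; the intermediate point stays in \<open>[W0, W1]\<close> because both 1 and
  \<open>s\<close> lie there.\<close>

lemma powr_difference_quotient:
  fixes m W0 W1 s :: real
  assumes m: "m < 1" and W: "0 < W0" "W0 \<le> 1" "1 \<le> W1" "W0 \<le> s" "s \<le> W1"
  obtains z where "W0 \<le> z" "z \<le> W1" "(s powr (m - 1) - 1) / (m - 1) = z powr (m - 2) * (s - 1)"
proof -
  define A where "A s = s powr (m - 1) / (m - 1)" for s :: real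
  have DA: "(A has_real_derivative s powr (m - 2)) (at s)" if "s > 0" for s
    unfolding A_def[abs_def]
    using DERIV_cdivide[OF has_real_derivative_powr[OF that, of "m - 1"], of "m - 1"] m by simp
  have "\<exists>z. W0 \<le> z \<and> z \<le> W1 \<and> A s - A 1 = z powr (m - 2) * (s - 1)"
  proof (cases s "1::real" rule: linorder_cases)
    case less
    have "\<exists>z. s < z \<and> z < 1 \<and> A 1 - A s = (1 - s) * z powr (m - 2)"
      using W by (intro MVT2[OF less] DA) auto
    then obtain z where z: "s < z" "z < 1" "A 1 - A s = (1 - s) * z powr (m - 2)" by blast
    then have "A s - A 1 = z powr (m - 2) * (s - 1)" by (simp add: algebra_simps)
    with z(1,2) W show ?thesis by (intro exI[of _ z]) auto
  next
    case greater
    have "\<exists>z. 1 < z \<and> z < s \<and> A s - A 1 = (s - 1) * z powr (m - 2)"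
      using W by (intro MVT2[OF greater] DA) auto
    then obtain z where z: "1 < z" "z < s" "A s - A 1 = (s - 1) * z powr (m - 2)" by blast
    then show ?thesis using W by (intro exI[of _ z]) auto
  qed (use W in auto)
  then show thesis using that by (auto simp: A_def diff_divide_distrib)
qed

text \<open>The exponent \<open>m - 2\<close> is negative, so the slope \<open>z^(m-2)\<close> is
  smallest at \<open>W1\<close>, which gives the first bound, and largest at \<open>W0\<close>,
  which gives the second.\<close>

lemma powr_quotient_bounds:
  fixes m W0 W1 s :: real
  assumes m: "m < 1" and W: "0 < W0" "W0 \<le> 1" "1 \<le> W1" "W0 \<le> s" "s \<le> W1"
  defines "A \<equiv> (s powr (m - 1) - 1) / (m - 1)"
  shows "(s - 1)\<^sup>2 \<le> W1 powr (2 * (2 - m)) * A\<^sup>2"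
    and "A\<^sup>2 \<le> W0 powr (2 * (m - 2)) * (s - 1)\<^sup>2"
proof -
  obtain z where z: "W0 \<le> z" "z \<le> W1" "A = z powr (m - 2) * (s - 1)"
    using powr_difference_quotient[OF m W] unfolding A_def by blast
  have z0: "z > 0" using z W by simp
  have A2: "A\<^sup>2 = z powr (2 * (m - 2)) * (s - 1)\<^sup>2"
    using z0 unfolding z(3) by (simp add: power_mult_distrib powr_power mult.commute)
  have "z powr (2 * (2 - m)) * z powr (2 * (m - 2)) = 1"
    using z0 by (simp add: powr_add[symmetric])
  then have "(s - 1)\<^sup>2 = z powr (2 * (2 - m)) * A\<^sup>2" unfolding A2 by (simp add: mult.assoc[symmetric])
  also have "\<dots> \<le> W1 powr (2 * (2 - m)) * A\<^sup>2"
    using z z0 m by (intro mult_right_mono powr_mono2) auto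
  finally show "(s - 1)\<^sup>2 \<le> W1 powr (2 * (2 - m)) * A\<^sup>2" .
  show "A\<^sup>2 \<le> W0 powr (2 * (m - 2)) * (s - 1)\<^sup>2"
    unfolding A2 using z W m by (intro mult_right_mono powr_mono2') auto
qed

text \<open>Taylor expansion at 1: value and slope vanish there, and the second derivative
  \<open>(1 - m) s^(m-2)\<close> is at most \<open>(1 - m) W0^(m-2)\<close>.\<close>

lemma entropy_density_le:
  fixes m W0 s :: real
  assumes m: "0 < m" "m < 1" and W: "0 < W0" "W0 \<le> 1" "W0 \<le> s"
  shows "(s - 1) - (1 / m) * (s powr m - 1) \<le> (1 - m) / 2 * W0 powr (m - 2) * (s - 1)\<^sup>2"
proof -
  define K where "K = W0 powr (m - 2)"
  define q where "q s = (1 - m) / 2 * K * (s - 1)\<^sup>2 - ((s - 1) - (1 / m) * (s powr m - 1))" for s :: real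
  define q' where "q' s = (1 - m) * K * (s - 1) - (1 - s powr (m - 1))" for s :: real
  have Dq: "(q has_real_derivative q' s) (at s)" if "s > 0" for s
    unfolding q_def[abs_def] q'_def using that m
    by (auto intro!: derivative_eq_intros has_real_derivative_powr simp: field_simps)
  \<comment> \<open>The gap \<open>q\<close> vanishes at 1, so it is nonnegative once it decreases
    before 1 and increases after.\<close>
  have sgn: "(z - 1) * q' z \<ge> 0" if z: "W0 \<le> z" for z
  proof -
    \<comment> \<open>With no upper bound on the argument at hand, \<open>max 1 z\<close> takes the
      place of \<open>W1\<close>.\<close>
    obtain y where y: "W0 \<le> y" "(z powr (m - 1) - 1) / (m - 1) = y powr (m - 2) * (z - 1)"
      using powr_difference_quotient[of m W0 "max 1 z" z] m W z by (metis max.cobounded1 max.cobounded2)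
    have "1 - z powr (m - 1) = (1 - m) * (y powr (m - 2) * (z - 1))"
      using m unfolding y(2)[symmetric] by (simp add: field_simps)
    then have "(z - 1) * q' z = (z - 1) * ((1 - m) * K * (z - 1) - (1 - m) * (y powr (m - 2) * (z - 1)))"
      by (simp only: q'_def)
    also have "\<dots> = (1 - m) * (K - y powr (m - 2)) * (z - 1)\<^sup>2"
      by (simp add: algebra_simps power2_eq_square)
    finally have "(z - 1) * q' z = (1 - m) * (K - y powr (m - 2)) * (z - 1)\<^sup>2" .
    moreover have "y powr (m - 2) \<le> K" unfolding K_def using y W m by (intro powr_mono2') auto
    ultimately show ?thesis using m by simp
  qed
  have "q 1 = 0" by (simp add: q_def)
  have "q s \<ge> 0"
  proof (cases s "1::real" rule: linorder_cases)
    case less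
    have "\<exists>z. s < z \<and> z < 1 \<and> q 1 - q s = (1 - s) * q' z"
      using W by (intro MVT2[OF less] Dq) auto
    then obtain z where z: "s < z" "z < 1" "q 1 - q s = (1 - s) * q' z" by blast
    then have "q' z \<le> 0" using sgn[of z] W by (auto simp: zero_le_mult_iff)
    then show ?thesis using z less \<open>q 1 = 0\<close> mult_nonneg_nonpos[of "1 - s" "q' z"] by simp
  next
    case greater
    have "\<exists>z. 1 < z \<and> z < s \<and> q s - q 1 = (s - 1) * q' z"
      using W by (intro MVT2[OF greater] Dq) auto
    then obtain z where z: "1 < z" "z < s" "q s - q 1 = (s - 1) * q' z" by blast
    then have "q' z \<ge> 0" using sgn[of z] W by (auto simp: zero_le_mult_iff)
    then show ?thesis using z greater \<open>q 1 = 0\<close> by simp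
  qed (use \<open>q 1 = 0\<close> in simp)
  then show ?thesis by (simp add: q_def K_def)
qed

theorem mainTheorem14:
  fixes w :: "real^'n::finite \<Rightarrow> real" and w' :: "real^'n \<Rightarrow> real^'n"
    and m D0 D1 Ds W0 W1 :: real
  assumes dim: "CARD('n) \<ge> 3"
    and m: "0 < m" "m < 1" "m \<noteq> m_star CARD('n)"
    and D: "0 < D1" "D1 \<le> Ds" "Ds \<le> D0"
    and C1: "\<forall>x. GDERIV w x :> w' x" "continuous_on UNIV w'"
    and sandwich: "\<forall>x. V m D0 x \<le> w x * V m Ds x \<and> w x * V m Ds x \<le> V m D1 x"
    and f_L1: "integrable lborel (\<lambda>x. (w x - 1) * V m Ds x)"
    and mass: "m > m_star CARD('n) \<Longrightarrow> (\<integral>x. (w x - 1) * V m Ds x \<partial>lborel) = 0"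
    and W: "0 < W0" "W0 \<le> 1" "1 \<le> W1" "\<forall>x. W0 \<le> w x \<and> w x \<le> W1"
    and ratio: "W1 / W0 < (1 + lambda_md TYPE('n) m Ds / (real CARD('n) * (1 - m)))
                            powr (1 / (2 * (2 - m)))"
  shows "let C = m / lambda_md TYPE('n) m Ds;
             \<gamma> = 2 * (m - C * real CARD('n) * (1 - m) * ((W1 / W0) powr (2 * (2 - m)) - 1))
                   / (C * W0 powr (m - 3) * W1 powr (2 * (2 - m)))
         in \<gamma> > 0 \<and> ennreal \<gamma> * F_ent m Ds w \<le> J_fish m Ds w"
proof -
  let ?d = "real CARD('n)" and ?c = "(1 - m) / m"
  define v where "v = (V m Ds :: real^'n \<Rightarrow> real)"
  define r where "r = (rho m Ds :: real^'n \<Rightarrow> real)"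
  define \<mu> where "\<mu> = lambda_md TYPE('n) m Ds"
  have Ds: "Ds > 0" using D by simp
  note mD = m(1,2) Ds
  have v0: "v x > 0" and r0: "r x > 0" for x
    by (simp_all add: v_def r_def V_pos[OF mD] rho_pos[OF mD])
  have cv: "continuous_on UNIV v" and cr: "continuous_on UNIV r"
    by (simp_all add: v_def r_def continuous_V[OF mD] continuous_rho)
  have w0: "w x > 0" and wW: "W0 \<le> w x" "w x \<le> W1" for x using W by (auto intro: less_le_trans)
  have w': "GDERIV w x :> w' x" for x using C1 by blast
  have cw: "continuous_on UNIV w" by (rule GDERIV_imp_continuous_on[OF w'])

  \<comment> \<open>Constants, the threshold, and positivity of \<open>\<gamma>\<close>\<close>
  define X where "X = (W1 / W0) powr (2 * (2 - m)) - 1"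
  have d1: "?d * (1 - m) > 0" using m dim by simp
  have WW: "W1 / W0 \<ge> 1" using W by simp
  have "\<mu> \<ge> 0" unfolding \<mu>_def by (rule lambda_md_nonneg[OF mD])
  have Xlt: "X < \<mu> / (?d * (1 - m))"
  proof -
    have "(W1 / W0) powr (2 * (2 - m)) < ((1 + \<mu> / (?d * (1 - m))) powr (1 / (2 * (2 - m)))) powr (2 * (2 - m))"
      using ratio WW m unfolding \<mu>_def by (intro powr_less_mono2) auto
    also have "\<dots> = 1 + \<mu> / (?d * (1 - m))"
      using m d1 \<open>\<mu> \<ge> 0\<close> by (simp add: powr_powr)
    finally show ?thesis by (simp add: X_def)
  qed
  have X0: "X \<ge> 0" using WW m by (simp add: X_def ge_one_powr_ge_zero)
  \<comment> \<open>So far the spectral constant is only nonnegative; \<open>0 \<le> X\<close> and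
    the strict ratio bound force it to be positive, which the divisions by \<open>\<mu>\<close> rely
    on.\<close>
  have \<mu>0: "\<mu> > 0" using Xlt X0 d1 by (smt (verit) divide_le_0_iff)
  define K1 where "K1 = W1 powr (2 * (2 - m))"
  have K1: "K1 > 0" using W by (simp add: K1_def)
  define K0 where "K0 = W0 powr (m - 2)"
  have K0: "K0 > 0" using W by (simp add: K0_def)
  define \<gamma> where "\<gamma> = 2 * (m - m / \<mu> * ?d * (1 - m) * X) / (m / \<mu> * W0 powr (m - 3) * K1)"
  \<comment> \<open>This form separates the three losses: \<open>K0\<close> from the entropy,
    \<open>K1\<close> from comparing gradients, and \<open>W0\<close> from the weight
    \<open>w\<close> in the Fisher information.\<close>
  have \<gamma>_eq: "\<gamma> = 2 * (\<mu> - ?d * (1 - m) * X) * W0 / (K0 * K1)"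
  proof -
    have "W0 powr (m - 3) = K0 / W0"
      using W powr_diff[of W0 "m - 2" 1] by (simp add: K0_def)
    moreover have "m - m / \<mu> * ?d * (1 - m) * X = (m / \<mu>) * (\<mu> - ?d * (1 - m) * X)"
      using \<mu>0 by (simp add: field_simps)
    ultimately show ?thesis using m \<mu>0 W K0 K1 by (simp add: \<gamma>_def)
  qed
  have gap: "\<mu> - ?d * (1 - m) * X > 0" using Xlt d1 by (simp add: field_simps)
  have \<gamma>0: "\<gamma> > 0" unfolding \<gamma>_eq using gap W K0 K1 by simp

  \<comment> \<open>Integrability of the terms without gradients\<close>
  obtain M where M: "\<And>x. \<bar>(w x - 1) * r x\<bar> \<le> M"
    using sandwich_bound[OF m(1,2) D sandwich] unfolding r_def by blast
  have f1: "integrable lborel (\<lambda>x. \<bar>(w x - 1) * v x\<bar>)"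
    using f_L1 unfolding v_def by (rule integrable_abs)
  define a where "a x = (w x powr (m - 1) - 1) / (m - 1)" for x
  define a' where "a' x = w x powr (m - 2) *\<^sub>R w' x" for x
  have a: "GDERIV a x :> a' x" for x
  proof -
    have "((\<lambda>s. (s powr (m - 1) - 1) / (m - 1)) has_real_derivative w x powr (m - 2)) (at (w x))"
      using w0[of x] m by (auto intro!: derivative_eq_intros)
    from GDERIV_DERIV_compose[OF w' this] show ?thesis by (simp add: a_def[abs_def] a'_def)
  qed
  have ca': "continuous_on UNIV a'"
    unfolding a'_def[abs_def] using w0
    by (intro continuous_intros cw C1) (simp add: less_imp_neq[symmetric])
  have ca: "continuous_on UNIV a" by (rule GDERIV_imp_continuous_on[OF a])
  have a_bounds: "(w x - 1)\<^sup>2 \<le> K1 * (a x)\<^sup>2" "(a x)\<^sup>2 \<le> W0 powr (2 * (m - 2)) * (w x - 1)\<^sup>2" for x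
    using powr_quotient_bounds[OF m(2) W(1-3) wW, of x] by (simp_all add: a_def K1_def)
  let ?L = "W0 powr (2 * (m - 2))"

  \<comment> \<open>One factor \<open>(w - 1) r\<close> is bounded thanks to the sandwich, and the
    remaining \<open>(w - 1) v\<close> is integrable by \<open>f_L1\<close>.\<close>
  have S1: "integrable lborel (\<lambda>x. (w x - 1)\<^sup>2 * (r x * v x))"
  proof (rule integrable_dominated[OF integrable_mult_right[OF f1, of M]])
    show "\<bar>(w x - 1)\<^sup>2 * (r x * v x)\<bar> \<le> M * \<bar>(w x - 1) * v x\<bar>" for x
    proof -
      have "\<bar>(w x - 1)\<^sup>2 * (r x * v x)\<bar> = \<bar>(w x - 1) * r x\<bar> * \<bar>(w x - 1) * v x\<bar>"
        by (simp add: abs_mult power2_eq_square)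
      also have "\<dots> \<le> M * \<bar>(w x - 1) * v x\<bar>" by (intro mult_right_mono M) simp
      finally show ?thesis .
    qed
  qed (intro continuous_intros cw cr cv)
  have Q1: "integrable lborel (\<lambda>x. (w x - 1)\<^sup>2 * (norm x)\<^sup>2 * v x)"
  proof (rule integrable_dominated[OF integrable_mult_right[OF S1, of "2 * m / (1 - m)"]])
    show "\<bar>(w x - 1)\<^sup>2 * (norm x)\<^sup>2 * v x\<bar> \<le> 2 * m / (1 - m) * ((w x - 1)\<^sup>2 * (r x * v x))" for x
    proof -
      have "(norm x)\<^sup>2 \<le> 2 * m / (1 - m) * r x"
        using rho_ge(2)[OF mD, of x] m by (simp add: r_def field_simps)
      then have "(w x - 1)\<^sup>2 * (norm x)\<^sup>2 * v x \<le> (w x - 1)\<^sup>2 * (2 * m / (1 - m) * r x) * v x"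
        using v0[of x] by (intro mult_right_mono mult_left_mono) auto
      then show ?thesis using v0[of x] by (simp add: abs_mult mult_ac)
    qed
  qed (intro continuous_intros cw cr cv)
  have S2: "integrable lborel (\<lambda>x. (a x)\<^sup>2 * (r x * v x))"
  proof (rule integrable_dominated[OF integrable_mult_right[OF S1, of ?L]])
    show "\<bar>(a x)\<^sup>2 * (r x * v x)\<bar> \<le> ?L * ((w x - 1)\<^sup>2 * (r x * v x))" for x
      using mult_right_mono[OF a_bounds(2)[of x], of "r x * v x"] r0[of x] v0[of x] by (simp add: abs_mult mult_ac)
  qed (intro continuous_intros ca cr cv)
  have Q2: "integrable lborel (\<lambda>x. (a x)\<^sup>2 * (norm x)\<^sup>2 * v x)"
  proof (rule integrable_dominated[OF integrable_mult_right[OF Q1, of ?L]])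
    show "\<bar>(a x)\<^sup>2 * (norm x)\<^sup>2 * v x\<bar> \<le> ?L * ((w x - 1)\<^sup>2 * (norm x)\<^sup>2 * v x)" for x
      using mult_right_mono[OF a_bounds(2)[of x], of "(norm x)\<^sup>2 * v x"] v0[of x] by (simp add: abs_mult mult_ac)
  qed (intro continuous_intros ca cr cv)

  \<comment> \<open>The Fisher information as a weighted Dirichlet integral\<close>
  define H where "H x = r x *\<^sub>R a' x + (a x * ?c) *\<^sub>R x" for x
  have cH: "continuous_on UNIV H"
    unfolding H_def[abs_def] by (intro continuous_intros ca ca' cr)
  define I where "I = (\<integral>\<^sup>+ x. ennreal ((norm (H x))\<^sup>2 * w x * v x) \<partial>lborel)"
  have cI: "continuous_on UNIV (\<lambda>x. (norm (H x))\<^sup>2 * w x * v x)"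
    by (intro continuous_intros cH cw cv)
  have J: "J_fish m Ds w = ennreal m * I"
  proof -
    have "grad (\<lambda>y. (w y powr (m - 1) - 1) * V m Ds y powr (m - 1)) x = (m - 1) *\<^sub>R H x" for x
    proof (rule grad_eq)
      have "GDERIV (\<lambda>y. a y * r y) x :> a x *\<^sub>R (?c *\<^sub>R x) + r x *\<^sub>R a' x"
        unfolding r_def by (rule GDERIV_mult[OF a GDERIV_rho[OF m(1)]])
      from GDERIV_mult[OF GDERIV_const[of "m - 1" x] this]
      have "GDERIV (\<lambda>y. (m - 1) * (a y * r y)) x :> (m - 1) *\<^sub>R H x"
        by (simp add: H_def add.commute)
      moreover have "(\<lambda>y. (m - 1) * (a y * r y)) = (\<lambda>y. (w y powr (m - 1) - 1) * V m Ds y powr (m - 1))"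
        using m by (auto simp: V_powr_minus[OF mD] a_def r_def)
      ultimately show "GDERIV (\<lambda>y. (w y powr (m - 1) - 1) * V m Ds y powr (m - 1)) x :> (m - 1) *\<^sub>R H x"
        by simp
    qed
    then have "J_fish m Ds w = ennreal (m / (m - 1)\<^sup>2) * (\<integral>\<^sup>+ x. ennreal ((m - 1)\<^sup>2) * ennreal ((norm (H x))\<^sup>2 * w x * v x) \<partial>lborel)"
      by (simp add: J_fish_def v_def power_mult_distrib ennreal_mult'[symmetric] mult.assoc)
    also have "\<dots> = ennreal (m / (m - 1)\<^sup>2) * (ennreal ((m - 1)\<^sup>2) * I)"
      unfolding I_def
      by (subst nn_integral_cmult) (auto intro!: borel_measurable_continuous_onI measurable_compose[OF _ measurable_ennreal] cI)
    also have "\<dots> = ennreal m * I"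
      using m by (simp add: mult.assoc[symmetric] ennreal_mult'[symmetric])
    finally show ?thesis .
  qed
  have main: "ennreal \<gamma> * F_ent m Ds w \<le> J_fish m Ds w"
  \<comment> \<open>An infinite right-hand side settles the inequality. Otherwise finiteness of
    \<open>I\<close> supplies the integrability of all gradient terms.\<close>
  proof (cases "I = \<infinity>")
    case True
    then show ?thesis using m by (simp add: J ennreal_mult_top)
  next
    case False
    have nn: "0 \<le> (norm (H x))\<^sup>2 * w x * v x" for x using w0[of x] v0[of x] by simp
    have iHw: "integrable lborel (\<lambda>x. (norm (H x))\<^sup>2 * w x * v x)"
      using False nn cI unfolding I_def
      by (intro integrableI_nonneg) (auto simp: less_top intro: borel_measurable_continuous_onI)
    define N2w where "N2w = (\<integral>x. (norm (H x))\<^sup>2 * w x * v x \<partial>lborel)"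
    have I_eq: "I = ennreal N2w"
      unfolding I_def N2w_def using iHw nn by (intro nn_integral_eq_integral) auto
    have Hw: "W0 * ((norm (H x))\<^sup>2 * v x) \<le> (norm (H x))\<^sup>2 * w x * v x" for x
      using mult_right_mono[OF wW(1)[of x], of "(norm (H x))\<^sup>2 * v x"] v0[of x] by (simp add: mult_ac)
    have iH: "integrable lborel (\<lambda>x. (norm (H x))\<^sup>2 * v x)"
    proof (rule integrable_dominated[OF integrable_mult_right[OF iHw, of "1 / W0"]])
      show "\<bar>(norm (H x))\<^sup>2 * v x\<bar> \<le> 1 / W0 * ((norm (H x))\<^sup>2 * w x * v x)" for x
        using Hw[of x] v0[of x] W(1) by (simp add: abs_mult field_simps)
    qed (intro continuous_intros cH cv)
    \<comment> \<open>Solve the definition of \<open>H\<close> for \<open>r a'\<close>: both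
      \<open>H\<close> and \<open>a x\<close> are already square integrable against
      \<open>v\<close>.\<close>
    have P2: "integrable lborel (\<lambda>x. (norm (a' x))\<^sup>2 * (r x)\<^sup>2 * v x)"
    proof (rule integrable_dominated[OF Bochner_Integration.integrable_add[OF
            integrable_mult_right[OF iH, of 2] integrable_mult_right[OF Q2, of "2 * ?c\<^sup>2"]]])
      show "\<bar>(norm (a' x))\<^sup>2 * (r x)\<^sup>2 * v x\<bar> \<le> 2 * ((norm (H x))\<^sup>2 * v x) + 2 * ?c\<^sup>2 * ((a x)\<^sup>2 * (norm x)\<^sup>2 * v x)" for x
      proof -
        have "(norm (a' x))\<^sup>2 * (r x)\<^sup>2 = (norm (H x + (- (a x * ?c)) *\<^sub>R x))\<^sup>2"
          by (simp add: H_def power_mult_distrib mult.commute)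
        also have "\<dots> \<le> (1 + 1) * (norm (H x))\<^sup>2 + (1 + 1 / 1) * (norm ((- (a x * ?c)) *\<^sub>R x))\<^sup>2"
          by (rule norm_add_squared_le) simp
        also have "\<dots> = 2 * (norm (H x))\<^sup>2 + 2 * ?c\<^sup>2 * ((a x)\<^sup>2 * (norm x)\<^sup>2)"
          by (simp only: norm_scaleR power_mult_distrib abs_minus_cancel power2_abs) (simp add: algebra_simps)
        finally show ?thesis
          using mult_right_mono[of "(norm (a' x))\<^sup>2 * (r x)\<^sup>2" "2 * (norm (H x))\<^sup>2 + 2 * ?c\<^sup>2 * ((a x)\<^sup>2 * (norm x)\<^sup>2)" "v x"] v0[of x]
          by (simp add: abs_mult distrib_right mult.assoc)
      qed
    qed (intro continuous_intros ca' cr cv)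
    \<comment> \<open>By the chain rule \<open>w' = w^(2-m) a'\<close>, so the gradients compare
      with the same constant \<open>K1\<close> as the functions.\<close>
    have w'_le: "(norm (w' x))\<^sup>2 * (r x)\<^sup>2 * v x \<le> K1 * ((norm (a' x))\<^sup>2 * (r x)\<^sup>2 * v x)" for x
    proof -
      have e: "(norm (a' x))\<^sup>2 = w x powr (2 * (m - 2)) * (norm (w' x))\<^sup>2"
        using w0[of x] by (simp add: a'_def power_mult_distrib powr_power mult.commute)
      have "w x powr (2 * (2 - m)) * w x powr (2 * (m - 2)) = 1"
        using w0[of x] by (simp add: powr_add[symmetric])
      then have "(norm (w' x))\<^sup>2 = w x powr (2 * (2 - m)) * (norm (a' x))\<^sup>2"
        unfolding e by (simp add: mult.assoc[symmetric])
      also have "\<dots> \<le> K1 * (norm (a' x))\<^sup>2"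
        unfolding K1_def using wW[of x] w0[of x] m by (intro mult_right_mono powr_mono2) auto
      finally have "(norm (w' x))\<^sup>2 * ((r x)\<^sup>2 * v x) \<le> K1 * (norm (a' x))\<^sup>2 * ((r x)\<^sup>2 * v x)"
        using v0[of x] by (intro mult_right_mono) auto
      then show ?thesis by (simp add: mult.assoc)
    qed
    have P1: "integrable lborel (\<lambda>x. (norm (w' x))\<^sup>2 * (r x)\<^sup>2 * v x)"
      by (rule integrable_dominated[OF integrable_mult_right[OF P2, of K1]])
         (use w'_le v0 in \<open>auto intro!: continuous_intros C1 cr cv simp: abs_mult abs_of_pos\<close>)

    \<comment> \<open>Comparison of the two Dirichlet integrals\<close>
    define N1 where "N1 = (\<integral>x. (norm (r x *\<^sub>R w' x + ((w x - 1) * ?c) *\<^sub>R x))\<^sup>2 * v x \<partial>lborel)"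
    define N2 where "N2 = (\<integral>x. (norm (H x))\<^sup>2 * v x \<partial>lborel)"
    define p1 where "p1 = (\<integral>x. (norm (w' x))\<^sup>2 * (r x)\<^sup>2 * v x \<partial>lborel)"
    define p2 where "p2 = (\<integral>x. (norm (a' x))\<^sup>2 * (r x)\<^sup>2 * v x \<partial>lborel)"
    define q1 where "q1 = (\<integral>x. (w x - 1)\<^sup>2 * (norm x)\<^sup>2 * v x \<partial>lborel)"
    define q2 where "q2 = (\<integral>x. (a x)\<^sup>2 * (norm x)\<^sup>2 * v x \<partial>lborel)"
    define s1 where "s1 = (\<integral>x. (w x - 1)\<^sup>2 * (r x * v x) \<partial>lborel)"
    define s2 where "s2 = (\<integral>x. (a x)\<^sup>2 * (r x * v x) \<partial>lborel)"
    have w1: "GDERIV (\<lambda>x. w x - 1) x :> w' x" for x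
      using GDERIV_diff[OF w' GDERIV_const[of 1 x]] by simp
    note id1 = weighted_gradient_identity[OF mD w1 C1(2) S1[unfolded r_def v_def] Q1[unfolded v_def] P1[unfolded r_def v_def], folded v_def r_def]
    note id2 = weighted_gradient_identity[OF mD a ca' S2[unfolded r_def v_def] Q2[unfolded v_def] P2[unfolded r_def v_def], folded v_def r_def]
    have N1: "N1 = p1 + (1 - m) / m\<^sup>2 * q1 - ?d * ?c * s1"
      unfolding N1_def p1_def q1_def s1_def by (rule id1(2))
    have N2: "N2 = p2 + (1 - m) / m\<^sup>2 * q2 - ?d * ?c * s2"
      unfolding N2_def p2_def q2_def s2_def H_def by (rule id2(2))
    have p: "p1 \<le> K1 * p2"
      unfolding p1_def p2_def integral_mult_right_zero[symmetric]
      using P1 P2 w'_le by (intro integral_mono) auto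
    have q: "q1 \<le> K1 * q2"
      unfolding q1_def q2_def integral_mult_right_zero[symmetric]
    proof (intro integral_mono Q1 integrable_mult_right Q2)
      show "(w x - 1)\<^sup>2 * (norm x)\<^sup>2 * v x \<le> K1 * ((a x)\<^sup>2 * (norm x)\<^sup>2 * v x)" for x
        using mult_right_mono[OF a_bounds(1)[of x], of "(norm x)\<^sup>2 * v x"] v0[of x] by (simp add: mult_ac)
    qed
    have s: "s2 \<le> ?L * s1"
      unfolding s1_def s2_def integral_mult_right_zero[symmetric]
    proof (intro integral_mono S2 integrable_mult_right S1)
      show "(a x)\<^sup>2 * (r x * v x) \<le> ?L * ((w x - 1)\<^sup>2 * (r x * v x))" for x
        using mult_right_mono[OF a_bounds(2)[of x], of "r x * v x"] r0[of x] v0[of x] by (simp add: mult_ac)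
    qed
    have s1: "s1 \<ge> 0"
      unfolding s1_def by (intro Bochner_Integration.integral_nonneg mult_nonneg_nonneg less_imp_le[OF r0] less_imp_le[OF v0]) auto
    \<comment> \<open>\<open>p\<close> and \<open>q\<close> were compared through \<open>W1\<close>,
      whereas \<open>s2\<close> is bounded above through \<open>W0\<close>; the product of the two
      constants is \<open>X + 1\<close>, and the 1 cancels against \<open>s1\<close>.\<close>
    have N12: "N1 \<le> K1 * N2 + ?d * ?c * X * s1"
    proof -
      have KL: "K1 * ?L = X + 1"
      proof -
        have e: "2 * (m - 2) = - (2 * (2 - m))" by simp
        show ?thesis
          using W unfolding K1_def X_def e powr_minus_divide by (simp add: powr_divide)
      qed
      have "(1 - m) / m\<^sup>2 * q1 \<le> (1 - m) / m\<^sup>2 * (K1 * q2)" using m by (intro mult_left_mono q) auto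
      then have "N1 \<le> K1 * (p2 + (1 - m) / m\<^sup>2 * q2) - ?d * ?c * s1"
        unfolding N1 using p by (simp add: algebra_simps)
      also have "\<dots> = K1 * N2 + ?d * ?c * (K1 * s2 - s1)"
      proof -
        have "K1 * y - e * s1 = K1 * (y - e * s2) + e * (K1 * s2 - s1)" for y e
          by (simp add: algebra_simps)
        then show ?thesis unfolding N2 .
      qed
      also have "\<dots> \<le> K1 * N2 + ?d * ?c * (K1 * (?L * s1) - s1)"
        using m K1 s by (intro add_left_mono mult_left_mono diff_right_mono) auto
      also have "K1 * (?L * s1) - s1 = X * s1"
        unfolding mult.assoc[symmetric] KL by (simp add: algebra_simps)
      finally show ?thesis by (simp add: mult.assoc)
    qed

    \<comment> \<open>The Hardy-Poincare inequality for \<open>g\<close>, and the conclusion\<close>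
    have HP: "\<mu> / m * s1 \<le> N1"
    proof -
      define g where "g x = (w x - 1) * r x" for x
      define g' where "g' x = r x *\<^sub>R w' x + ((w x - 1) * ?c) *\<^sub>R x" for x
      define u where "u x = v x / r x" for x
      define \<kappa> where "\<kappa> = (if m < m_star CARD('n) then 0 else 1 / (\<integral>x. u x \<partial>lborel))"
      have gu: "(g x)\<^sup>2 * u x = (w x - 1)\<^sup>2 * (r x * v x)" "g x * u x = (w x - 1) * v x" for x
        using r0[of x] by (simp_all add: g_def u_def power2_eq_square)
      have "\<mu> / m * (\<integral>x. (g x)\<^sup>2 * u x \<partial>lborel) \<le> (\<integral>x. (norm (g' x))\<^sup>2 * v x \<partial>lborel)"
      proof (rule quadratic_inequality_bounded[where \<kappa>=\<kappa> and K="Ds + (1 - m) / (2 * m)" and M=M])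
        show "CARD('n) \<ge> 3" by (rule dim)
        show "continuous_on UNIV v" by (rule cv)
        show "continuous_on UNIV u"
          unfolding u_def[abs_def] by (intro continuous_intros cv cr) (simp add: r0 less_imp_neq[symmetric])
        show "v x \<ge> 0" "u x \<ge> 0" for x using v0[of x] r0[of x] by (auto simp: u_def)
        show "\<mu> / m * ((\<integral>x. (h x)\<^sup>2 * u x \<partial>lborel) - \<kappa> * (\<integral>x. h x * u x \<partial>lborel)\<^sup>2)
            \<le> (\<integral>x. (norm (grad h x))\<^sup>2 * v x \<partial>lborel)" if "test_fn h" for h
          unfolding \<mu>_def \<kappa>_def u_def v_def r_def by (rule lambda_md_test_fn[OF mD that])
        \<comment> \<open>Here \<open>v = r u\<close>, and for \<open>norm x \<ge> 1\<close> the
          constant part \<open>Ds\<close> of \<open>r\<close> is at most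
          \<open>Ds |x|^2\<close>.\<close>
        show "v x \<le> (Ds + (1 - m) / (2 * m)) * (x \<bullet> x) * u x" if "norm x \<ge> 1" for x
        proof -
          have "1 \<le> x \<bullet> x" using power_mono[OF that, of 2] by (simp add: power2_norm_eq_inner)
          then have "r x \<le> (Ds + (1 - m) / (2 * m)) * (x \<bullet> x)"
            using Ds unfolding r_def rho_def power2_norm_eq_inner by (simp add: distrib_right)
          then have "r x * u x \<le> (Ds + (1 - m) / (2 * m)) * (x \<bullet> x) * u x"
            using v0[of x] r0[of x] by (intro mult_right_mono) (auto simp: u_def)
          then show ?thesis using r0[of x] by (simp add: u_def)
        qed
        show "GDERIV g x :> g' x" for x
          using GDERIV_mult[OF w1 GDERIV_rho[OF m(1), of Ds x]] unfolding g_def[abs_def] g'_def r_def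
          by (simp add: add.commute)
        show "continuous_on UNIV g'"
          unfolding g'_def[abs_def] by (intro continuous_intros cw C1 cr)
        show "\<bar>g x\<bar> \<le> M" for x unfolding g_def by (rule M)
        show "integrable lborel (\<lambda>x. (g x)\<^sup>2 * u x)" unfolding gu by (rule S1)
        show "integrable lborel (\<lambda>x. (norm (g' x))\<^sup>2 * v x)" unfolding g'_def by (rule id1(1))
        \<comment> \<open>Below \<open>m_star\<close> no mean is subtracted; otherwise
          \<open>m \<noteq> m_star\<close> puts \<open>m\<close> above it, and \<open>mass\<close>
          gives the vanishing mean of \<open>g\<close>.\<close>
        show "\<kappa> = 0 \<or> integrable lborel (\<lambda>x. g x * u x) \<and> (\<integral>x. g x * u x \<partial>lborel) = 0"
          using f_L1 mass m(3) unfolding gu v_def \<kappa>_def by auto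
      qed
      then show ?thesis unfolding gu s1_def N1_def g'_def .
    qed
    have N2w: "W0 * N2 \<le> N2w"
      unfolding N2_def N2w_def integral_mult_right_zero[symmetric]
      by (intro integral_mono integrable_mult_right iH iHw Hw)
    \<comment> \<open>Multiplying by \<open>m\<close> clears the denominators of
      \<open>\<mu> / m\<close> and \<open>?c\<close>; the surplus in \<open>s1\<close> moves to the
      left and leaves the coefficient shown positive in \<open>gap\<close>.\<close>
    have key: "(\<mu> - ?d * (1 - m) * X) * s1 \<le> m * (K1 * N2)"
    proof -
      have "m * (\<mu> / m * s1) \<le> m * (K1 * N2 + ?d * ?c * X * s1)"
        using HP N12 m by (intro mult_left_mono) auto
      also have "\<dots> = m * (K1 * N2) + (m * ?c) * (?d * X * s1)" by (simp only: distrib_left mult_ac)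
      also have "m * ?c = 1 - m" using m by simp
      also have "m * (\<mu> / m * s1) = \<mu> * s1" using m by simp
      finally show ?thesis by (simp add: algebra_simps)
    qed
    have F: "F_ent m Ds w \<le> ennreal (1 / 2 * K0 * s1)"
    proof -
      have "(\<integral>\<^sup>+ x. ennreal (((w x - 1) - (1 / m) * (w x powr m - 1)) * V m Ds x powr m) \<partial>lborel)
          \<le> (\<integral>\<^sup>+ x. ennreal ((1 - m) / 2 * K0 * ((w x - 1)\<^sup>2 * (r x * v x))) \<partial>lborel)"
      proof (intro nn_integral_mono ennreal_leI)
        fix x
        have "((w x - 1) - (1 / m) * (w x powr m - 1)) * (r x * v x) \<le> ((1 - m) / 2 * K0 * (w x - 1)\<^sup>2) * (r x * v x)"
          unfolding K0_def using r0[of x] v0[of x]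
          by (intro mult_right_mono entropy_density_le[OF m(1,2) W(1,2) wW(1)]) auto
        then show "((w x - 1) - (1 / m) * (w x powr m - 1)) * V m Ds x powr m \<le> (1 - m) / 2 * K0 * ((w x - 1)\<^sup>2 * (r x * v x))"
          by (simp add: V_powr_m[OF mD] r_def v_def mult.assoc)
      qed
      also have "\<dots> = ennreal (\<integral>x. (1 - m) / 2 * K0 * ((w x - 1)\<^sup>2 * (r x * v x)) \<partial>lborel)"
        using m K0 r0 v0 by (intro nn_integral_eq_integral integrable_mult_right S1 AE_I2 mult_nonneg_nonneg less_imp_le[OF r0] less_imp_le[OF v0]) auto
      also have "\<dots> = ennreal ((1 - m) / 2 * K0 * s1)" by (simp add: s1_def)
      finally have "F_ent m Ds w \<le> ennreal (1 / (1 - m)) * ennreal ((1 - m) / 2 * K0 * s1)"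
        unfolding F_ent_def by (rule mult_left_mono) simp
      also have "\<dots> = ennreal (1 / 2 * K0 * s1)"
        using m by (simp add: ennreal_mult'[symmetric])
      finally show ?thesis .
    qed
    have "ennreal \<gamma> * F_ent m Ds w \<le> ennreal \<gamma> * ennreal (1 / 2 * K0 * s1)"
      using F by (rule mult_left_mono) simp
    also have "\<dots> = ennreal (\<gamma> * (1 / 2 * K0 * s1))"
      using \<gamma>0 by (intro ennreal_mult'[symmetric]) simp
    also have "\<dots> \<le> ennreal (m * N2w)"
    proof (rule ennreal_leI)
      have "\<gamma> * (1 / 2 * K0 * s1) = W0 / K1 * ((\<mu> - ?d * (1 - m) * X) * s1)"
      proof -
        have "2 * y * W0 / (K0 * K1) * (1 / 2 * K0 * s1) = W0 / K1 * (y * s1)" for y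
          using K0 K1 by simp
        then show ?thesis unfolding \<gamma>_eq .
      qed
      also have "\<dots> \<le> W0 / K1 * (m * (K1 * N2))" using key W K1 by (intro mult_left_mono) auto
      also have "\<dots> = m * (W0 * N2)" using K1 by simp
      also have "\<dots> \<le> m * N2w" using N2w m by (intro mult_left_mono) auto
      finally show "\<gamma> * (1 / 2 * K0 * s1) \<le> m * N2w" .
    qed
    also have "\<dots> = J_fish m Ds w" using m by (simp add: J I_eq ennreal_mult')
    finally show ?thesis .
  qed
  show ?thesis
    using \<gamma>0 main unfolding \<gamma>_def \<mu>_def K1_def X_def by (simp add: Let_def)
qed

end
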